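(* Let $G$ be a locally compact Polish left topological group, let $C\in\operatorname{NC}(G)$, and let $S$ be a subsemigroup of $G$ such that $S$ is dense in an open subset of $G$ with non-compact closure. Then there exists an open subset $P$ of $G$ such that $C\subseteq P$, $P\in\operatorname{NC}(G)^+$, and for every finite coloring of $S\setminus P$ there exists a family $\mathcal A$ of sequences in $S\setminus P$ which satisfies the following conditions: (i) each $A\in\mathcal A$ is closed and discrete in $G$; (ii) the set $\bigcup_{A\in\mathcal A}\operatorname{FS}(A)$ is monochromatic (in particular it is contained in $S\setminus P$); (iii) $\operatorname{FS}(A)\cap\operatorname{FS}(B)=\emptyset$ for all distinct $A,B\in\mathcal A$; (iv) the set $\bigcup_{A\in\mathcal A}\operatorname{FS}(A)$ is dense in an open subset of $G$ with non-compact closure. Moreover, if $\operatorname{NC}(G)$ is additionally nicely exhaustive with respect to $S$, then the families $\mathcal A$ can be chosen so that also (v) $\operatorname{FS}(A)$ is a closed discrete subset of $G$ for all $A\in\mathcal A$.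
   Context: $\mathbb N$ is the set of positive integers. Sequences are injective, indexed by $\mathbb N$, and identified with their images. For a sequence $A=\{a(n):n\in\mathbb N\}$ in a semigroup, $\operatorname{FS}(A)=A\cup\{a(n_1)a(n_2)\cdots a(n_k): k\ge 2,\ n_1<n_2<\dots<n_k\}$. A finite coloring of a set is a map from it to a finite set; a subset is monochromatic if the coloring is defined and constant on it. A left topological group is a group with a topology such that every left shift $x\mapsto sx$ is continuous. Polish means separable and completely metrizable. An ideal on a set $X$ is a nonempty $J\subseteq\mathcal P(X)$ with $X\notin J$, closed under finite unions and under taking subsets; $J^+=\mathcal P(X)\setminus J$. For a non-compact Hausdorff space $X$, $\operatorname{NC}(X)$ is the ideal of all sets contained in the union of a compact subset of $X$ and a nowhere dense subset of $X$. (Under the hypotheses above, $G$ is non-compact.) A set $E\subseteq G$ is dense in an open set $Q\subseteq G$ if $E\cap Q$ is dense in $Q$; "an open subset with non-compact closure" means an open $Q\subseteq G$ whose closure in $G$ is not compact. A subset $A$ of a semigroup $S$ is a left ideal if $SA\subseteq A$. For a subsemigroup $S$ of a left topological group $G$, an ideal $J$ on $G$ is nicely exhaustive with respect to $S$ if there is a family $\{A_i:i\in\mathbb N\}\subseteq J$ of open sets such that $\bigcup_iA_i=G$, $A_i\subseteq A_{i+1}$ for all $i$, and $S\setminus A_i$ is a nonempty left ideal in $S$ for each $i$. *)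

theory Defs
  imports "HOL-Analysis.Analysis" "HOL-Algebra.Group"
begin

definition left_topological_group :: "('a, 'b) monoid_scheme \<Rightarrow> 'a topology \<Rightarrow> bool" where
  "left_topological_group G X \<longleftrightarrow>
     group G \<and> topspace X = carrier G \<and>
     (\<forall>s\<in>carrier G. continuous_map X X (\<lambda>x. s \<otimes>\<^bsub>G\<^esub> x))"

definition Polish_topology :: "'a topology \<Rightarrow> bool" where
  "Polish_topology X \<longleftrightarrow> separable_space X \<and> completely_metrizable_space X"

definition subsemigroup :: "('a, 'b) monoid_scheme \<Rightarrow> 'a set \<Rightarrow> bool" where
  "subsemigroup G S \<longleftrightarrow>
     S \<noteq> {} \<and> S \<subseteq> carrier G \<and> (\<forall>x\<in>S. \<forall>y\<in>S. x \<otimes>\<^bsub>G\<^esub> y \<in> S)"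

definition left_ideal_of :: "('a, 'b) monoid_scheme \<Rightarrow> 'a set \<Rightarrow> 'a set \<Rightarrow> bool" where
  "left_ideal_of G S A \<longleftrightarrow> A \<subseteq> S \<and> (\<forall>s\<in>S. \<forall>a\<in>A. s \<otimes>\<^bsub>G\<^esub> a \<in> A)"

text \<open>
  Sequences are functions on \<^typ>\<open>nat\<close>, so their indices start at 0. The order of the indices
  matters because the group need not be commutative: \<open>foldr\<close> multiplies the terms from left to
  right in the order of increasing indices, and the final unit is absorbed.
\<close>

definition FS :: "('a, 'b) monoid_scheme \<Rightarrow> (nat \<Rightarrow> 'a) \<Rightarrow> 'a set" where
  "FS G a = range a \<union>
     {foldr (\<lambda>x y. x \<otimes>\<^bsub>G\<^esub> y) (map a ns) \<one>\<^bsub>G\<^esub> | ns. length ns \<ge> 2 \<and> sorted_wrt (<) ns}"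

text \<open>
  Colors are natural numbers, which covers colorings with values in any finite set. Values of
  \<open>c\<close> outside \<open>D\<close> are irrelevant.
\<close>

definition finite_coloring :: "'a set \<Rightarrow> ('a \<Rightarrow> nat) \<Rightarrow> bool" where
  "finite_coloring D c \<longleftrightarrow> finite (c ` D)"

definition monochromatic :: "'a set \<Rightarrow> ('a \<Rightarrow> nat) \<Rightarrow> 'a set \<Rightarrow> bool" where
  "monochromatic D c M \<longleftrightarrow> M \<subseteq> D \<and> (\<exists>k. \<forall>x\<in>M. c x = k)"

definition set_ideal :: "'a set \<Rightarrow> 'a set set \<Rightarrow> bool" where
  "set_ideal U J \<longleftrightarrow>
     J \<noteq> {} \<and> J \<subseteq> Pow U \<and> U \<notin> J \<and>
     (\<forall>A\<in>J. \<forall>B\<in>J. A \<union> B \<in> J) \<and> (\<forall>A\<in>J. \<forall>B. B \<subseteq> A \<longrightarrow> B \<in> J)"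

definition ideal_positive :: "'a set \<Rightarrow> 'a set set \<Rightarrow> 'a set set" where
  "ideal_positive U J = Pow U - J"

definition nowhere_dense_in :: "'a topology \<Rightarrow> 'a set \<Rightarrow> bool" where
  "nowhere_dense_in X N \<longleftrightarrow> N \<subseteq> topspace X \<and> X interior_of (X closure_of N) = {}"

definition NC :: "'a topology \<Rightarrow> 'a set set" where
  "NC X = {A. \<exists>K N. compactin X K \<and> nowhere_dense_in X N \<and> A \<subseteq> K \<union> N}"

definition closed_discrete_in :: "'a topology \<Rightarrow> 'a set \<Rightarrow> bool" where
  "closed_discrete_in X A \<longleftrightarrow> closedin X A \<and> subtopology X A = discrete_topology A"

definition dense_in_open :: "'a topology \<Rightarrow> 'a set \<Rightarrow> 'a set \<Rightarrow> bool" where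
  "dense_in_open X E Q \<longleftrightarrow> openin X Q \<and> (subtopology X Q) closure_of (E \<inter> Q) = Q"

definition dense_in_noncompact_open :: "'a topology \<Rightarrow> 'a set \<Rightarrow> bool" where
  "dense_in_noncompact_open X E \<longleftrightarrow>
     (\<exists>Q. dense_in_open X E Q \<and> \<not> compactin X (X closure_of Q))"

definition nicely_exhaustive ::
    "('a, 'b) monoid_scheme \<Rightarrow> 'a topology \<Rightarrow> 'a set \<Rightarrow> 'a set set \<Rightarrow> bool" where
  "nicely_exhaustive G X S J \<longleftrightarrow>
     set_ideal (carrier G) J \<and>
     (\<exists>A :: nat \<Rightarrow> 'a set.
        (\<forall>i. A i \<in> J \<and> openin X (A i)) \<and>
        (\<Union>i. A i) = carrier G \<and>
        (\<forall>i. A i \<subseteq> A (Suc i)) \<and>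
        (\<forall>i. S - A i \<noteq> {} \<and> left_ideal_of G S (S - A i)))"

lemma nowhere_dense_in_Un:
  assumes "nowhere_dense_in X M" "nowhere_dense_in X N"
  shows "nowhere_dense_in X (M \<union> N)"
proof -
  have "X interior_of (X closure_of M \<union> X closure_of N) = {}"
    using assms closedin_closure_of[of X M]
    by (simp add: nowhere_dense_in_def interior_of_union_eq_empty)
  then show ?thesis
    using assms by (simp add: nowhere_dense_in_def closure_of_Un)
qed

lemma set_ideal_NC:
  assumes "Hausdorff_space X" "\<not> compact_space X"
  shows "set_ideal (topspace X) (NC X)"
proof -
  have "topspace X \<notin> NC X"
  proof
    assume "topspace X \<in> NC X"
    then obtain K N where K: "compactin X K" and N: "nowhere_dense_in X N"
      and sub: "topspace X \<subseteq> K \<union> N"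
      by (auto simp: NC_def)
    have cl: "closedin X K"
      using K assms(1) compactin_imp_closedin by blast
    have "topspace X - K \<subseteq> X closure_of N"
      using sub N closure_of_subset[of N X] by (auto simp: nowhere_dense_in_def)
    moreover have "openin X (topspace X - K)"
      using cl by blast
    ultimately have "topspace X - K \<subseteq> X interior_of (X closure_of N)"
      by (simp add: interior_of_maximal)
    then have "topspace X = K"
      using N compactin_subset_topspace[OF K] by (auto simp: nowhere_dense_in_def)
    then show False
      using K assms(2) by (simp add: compact_space_def)
  qed
  moreover have "{} \<in> NC X"
    unfolding NC_def nowhere_dense_in_def
    by (auto intro!: exI[of _ "{}"])
  moreover have "NC X \<subseteq> Pow (topspace X)"
    unfolding NC_def nowhere_dense_in_def
    using compactin_subset_topspace by fastforce
  moreover have "A \<union> B \<in> NC X" if A: "A \<in> NC X" and B: "B \<in> NC X" for A B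
  proof -
    obtain K M L N where "compactin X K" "nowhere_dense_in X M" "A \<subseteq> K \<union> M"
      "compactin X L" "nowhere_dense_in X N" "B \<subseteq> L \<union> N"
      using A B unfolding NC_def by blast
    then have "compactin X (K \<union> L)" "nowhere_dense_in X (M \<union> N)" "A \<union> B \<subseteq> (K \<union> L) \<union> (M \<union> N)"
      using compactin_Un nowhere_dense_in_Un by blast+
    then show ?thesis
      unfolding NC_def by blast
  qed
  moreover have "B \<in> NC X" if "A \<in> NC X" "B \<subseteq> A" for A B
    using that unfolding NC_def by blast
  ultimately show ?thesis
    unfolding set_ideal_def by blast
qed

end

theory Submission
  imports Defs "HOL-Library.Nat_Bijection"
begin

text \<open>
  The ultrafilters that contain no set of \<open>NC X\<close> form a closed left ideal, hence a compact right
  topological semigroup. To find an idempotent one that contains \<open>S - P\<close> for a suitable \<open>P\<close>, choose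
  small open blocks \<open>B j\<close> that tend to infinity so fast that \<open>B j\<close> and its translates by the
  finitely many products formed earlier stay away from \<open>C\<close> and eventually from each compact set.
  The union \<open>F\<close> of the closures of all these translates is closed and disjoint from \<open>C\<close>, its
  complement \<open>P\<close> is not in \<open>NC X\<close>, and the products starting beyond the \<open>n\<close>-th block generate a
  filter that corresponds to a closed subsemigroup.

  Let \<open>p\<close> be idempotent in that subsemigroup, \<open>M\<close> a color class in \<open>p\<close>, and \<open>M'\<close> the set of those
  \<open>x \<in> M\<close> with \<open>{y. x y \<in> M} \<in> p\<close>. As \<open>M'\<close> is in \<open>p\<close>, it is dense in an open set with non-compact
  closure. Galvin's argument starts a sequence with products in \<open>M'\<close> at every point of \<open>M'\<close>; doing
  this simultaneously for a dense set of starting points, each new term only has to avoid a set of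
  \<open>NC X\<close> to keep the products disjoint and to drive the sequences to infinity.
\<close>

section \<open>Idempotent ultrafilters\<close>

text \<open>Members may stick out of \<open>S\<close>; as \<open>S \<in> \<phi>\<close>, membership
  depends only on the trace on \<open>S\<close>, so preimages need not be intersected with
  \<open>S\<close>.\<close>

definition set_filter :: "'a set \<Rightarrow> 'a set set \<Rightarrow> bool" where
  "set_filter S \<phi> \<longleftrightarrow>
     S \<in> \<phi> \<and> {} \<notin> \<phi> \<and> (\<forall>A\<in>\<phi>. \<forall>B\<in>\<phi>. A \<inter> B \<in> \<phi>) \<and> (\<forall>A\<in>\<phi>. \<forall>B. A \<subseteq> B \<longrightarrow> B \<in> \<phi>)"

text \<open>Says that \<open>\<phi>\<close> is contained in its product with itself. For an
  ultrafilter, maximality turns this inclusion into equality, that is, idempotence.\<close>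

definition shift_closed :: "('a \<Rightarrow> 'a \<Rightarrow> 'a) \<Rightarrow> 'a set set \<Rightarrow> bool" where
  "shift_closed f \<phi> \<longleftrightarrow> (\<forall>A\<in>\<phi>. {x. {y. f x y \<in> A} \<in> \<phi>} \<in> \<phi>)"

lemma set_filterD:
  assumes "set_filter S \<phi>"
  shows set_filter_top: "S \<in> \<phi>"
    and set_filter_empty: "{} \<notin> \<phi>"
    and set_filter_Int: "\<And>A B. A \<in> \<phi> \<Longrightarrow> B \<in> \<phi> \<Longrightarrow> A \<inter> B \<in> \<phi>"
    and set_filter_mono: "\<And>A B. A \<in> \<phi> \<Longrightarrow> A \<subseteq> B \<Longrightarrow> B \<in> \<phi>"
  using assms unfolding set_filter_def by blast+

lemma set_filter_Union_chain:
  assumes "\<C> \<noteq> {}" "subset.chain \<A> \<C>" "\<And>\<phi>. \<phi> \<in> \<A> \<Longrightarrow> set_filter S \<phi>"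
  shows "set_filter S (\<Union>\<C>)"
proof -
  have filt: "set_filter S \<phi>" if "\<phi> \<in> \<C>" for \<phi>
    using assms(2,3) that by (auto simp: subset_chain_def)
  have "A \<inter> B \<in> \<Union>\<C>" if AB: "A \<in> \<Union>\<C>" "B \<in> \<Union>\<C>" for A B
  proof -
    obtain \<phi> \<psi> where "\<phi> \<in> \<C>" "A \<in> \<phi>" "\<psi> \<in> \<C>" "B \<in> \<psi>"
      using AB by blast
    moreover from this have "\<phi> \<subseteq> \<psi> \<or> \<psi> \<subseteq> \<phi>"
      using assms(2) by (auto simp: subset_chain_def)
    ultimately obtain \<rho> where "\<rho> \<in> \<C>" "A \<in> \<rho>" "B \<in> \<rho>"
      by blast
    then show ?thesis
      using set_filter_Int[OF filt] by blast
  qed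
  moreover have "S \<in> \<Union>\<C>"
    using assms(1) set_filter_top[OF filt] by blast
  moreover have "{} \<notin> \<Union>\<C>"
    using set_filter_empty[OF filt] by blast
  moreover have "B \<in> \<Union>\<C>" if "A \<in> \<Union>\<C>" "A \<subseteq> B" for A B
    using that set_filter_mono[OF filt] by blast
  ultimately show ?thesis
    unfolding set_filter_def by blast
qed

lemma shift_closed_Union_chain:
  assumes "\<And>\<phi>. \<phi> \<in> \<C> \<Longrightarrow> set_filter S \<phi>" "\<And>\<phi>. \<phi> \<in> \<C> \<Longrightarrow> shift_closed f \<phi>"
  shows "shift_closed f (\<Union>\<C>)"
  unfolding shift_closed_def
proof
  fix A assume "A \<in> \<Union>\<C>"
  then obtain \<phi> where \<phi>: "\<phi> \<in> \<C>" "A \<in> \<phi>"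
    by blast
  then have "{x. {y. f x y \<in> A} \<in> \<phi>} \<in> \<phi>"
    using assms(2) by (auto simp: shift_closed_def)
  then have "{x. {y. f x y \<in> A} \<in> \<Union>\<C>} \<in> \<phi>"
    by (rule set_filter_mono[OF assms(1)[OF \<phi>(1)]]) (use \<phi> in blast)
  then show "{x. {y. f x y \<in> A} \<in> \<Union>\<C>} \<in> \<Union>\<C>"
    using \<phi>(1) by blast
qed

text \<open>Zorn's lemma gives a maximal filter. If it misses \<open>- A\<close>, then together with
  \<open>A\<close> it generates a proper filter, which cannot be larger.\<close>

lemma ex_ultra_set_filter:
  assumes "set_filter S \<phi>"
  obtains p where "set_filter S p" "\<phi> \<subseteq> p" "\<And>A. A \<in> p \<or> - A \<in> p"
proof -
  define \<A> where "\<A> = {p. set_filter S p \<and> \<phi> \<subseteq> p}"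
  have "\<Union>\<C> \<in> \<A>" if "\<C> \<noteq> {}" "subset.chain \<A> \<C>" for \<C>
  proof -
    have "set_filter S (\<Union>\<C>)"
      by (rule set_filter_Union_chain[OF that]) (simp add: \<A>_def)
    moreover have "\<phi> \<subseteq> \<Union>\<C>"
      using that by (fastforce simp: subset_chain_def \<A>_def)
    ultimately show ?thesis
      by (simp add: \<A>_def)
  qed
  moreover have "\<phi> \<in> \<A>"
    using assms by (simp add: \<A>_def)
  ultimately obtain p where p: "p \<in> \<A>" and max: "\<And>q. q \<in> \<A> \<Longrightarrow> p \<subseteq> q \<Longrightarrow> q = p"
    using subset_Zorn_nonempty[of \<A>] by blast
  have filt: "set_filter S p"
    using p by (simp add: \<A>_def)
  have "A \<in> p" if nA: "- A \<notin> p" for A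
  proof -
    define q where "q = {B. \<exists>E\<in>p. E \<inter> A \<subseteq> B}"
    have "{} \<notin> q"
    proof
      assume "{} \<in> q"
      then obtain E where "E \<in> p" "E \<subseteq> - A"
        by (auto simp: q_def)
      then show False
        using nA set_filter_mono[OF filt] by blast
    qed
    moreover have "S \<in> q"
      using set_filter_top[OF filt] by (auto simp: q_def)
    moreover have "B \<inter> B' \<in> q" if B: "B \<in> q" "B' \<in> q" for B B'
    proof -
      obtain E E' where "E \<in> p" "E' \<in> p" "E \<inter> A \<subseteq> B" "E' \<inter> A \<subseteq> B'"
        using B unfolding q_def by blast
      then show ?thesis
        unfolding q_def by (intro CollectI bexI[of _ "E \<inter> E'"] set_filter_Int[OF filt]) auto
    qed
    moreover have "B' \<in> q" if "B \<in> q" "B \<subseteq> B'" for B B'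
      using that unfolding q_def by blast
    ultimately have "set_filter S q"
      unfolding set_filter_def by blast
    moreover have pq: "p \<subseteq> q"
      by (auto simp: q_def)
    ultimately have "q = p"
      using p by (intro max) (auto simp: \<A>_def)
    then show ?thesis
      using set_filter_top[OF filt] by (auto simp: q_def)
  qed
  then show thesis
    using that[OF filt] p by (auto simp: \<A>_def)
qed

text \<open>
  The filter form of the Ellis--Numakura lemma. A filter \<open>\<phi>\<close> with \<open>shift_closed f \<phi>\<close> corresponds to
  a closed subsemigroup of the space of ultrafilters, so a maximal one plays the role of a minimal
  closed subsemigroup. For an ultrafilter \<open>p\<close> above it, \<open>\<rho>\<close> is the product of \<open>\<phi>\<close> and \<open>p\<close>, and
  \<open>\<psi>\<close> corresponds to the stabilizer of \<open>p\<close>; both have to equal \<open>\<phi>\<close>.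
\<close>

theorem ex_idempotent_ultrafilter:
  fixes f :: "'a \<Rightarrow> 'a \<Rightarrow> 'a"
  assumes closed: "\<And>x y. x \<in> S \<Longrightarrow> y \<in> S \<Longrightarrow> f x y \<in> S"
    and assoc: "\<And>x y z. x \<in> S \<Longrightarrow> y \<in> S \<Longrightarrow> z \<in> S \<Longrightarrow> f (f x y) z = f x (f y z)"
    and \<phi>0: "set_filter S \<phi>0" "shift_closed f \<phi>0"
  shows "\<exists>p. set_filter S p \<and> shift_closed f p \<and> \<phi>0 \<subseteq> p \<and> (\<forall>A. A \<in> p \<or> - A \<in> p)"
proof -
  define \<A> where "\<A> = {\<phi>. set_filter S \<phi> \<and> shift_closed f \<phi> \<and> \<phi>0 \<subseteq> \<phi>}"
  have "\<Union>\<C> \<in> \<A>" if ch: "\<C> \<noteq> {}" "subset.chain \<A> \<C>" for \<C>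
  proof -
    have sub: "\<C> \<subseteq> \<A>"
      using ch by (simp add: subset_chain_def)
    have "set_filter S (\<Union>\<C>)"
      by (rule set_filter_Union_chain[OF ch]) (simp add: \<A>_def)
    moreover have "shift_closed f (\<Union>\<C>)"
      by (rule shift_closed_Union_chain[of _ S]) (use sub in \<open>auto simp: \<A>_def\<close>)
    moreover have "\<phi>0 \<subseteq> \<Union>\<C>"
      using ch sub by (fastforce simp: \<A>_def)
    ultimately show ?thesis
      by (simp add: \<A>_def)
  qed
  moreover have "\<phi>0 \<in> \<A>"
    using \<phi>0 by (simp add: \<A>_def)
  ultimately obtain \<phi> where \<phi>A: "\<phi> \<in> \<A>" and max: "\<And>q. q \<in> \<A> \<Longrightarrow> \<phi> \<subseteq> q \<Longrightarrow> q = \<phi>"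
    using subset_Zorn_nonempty[of \<A>] by blast
  have \<phi>: "set_filter S \<phi>" and \<phi>s: "\<And>A. A \<in> \<phi> \<Longrightarrow> {x. {y. f x y \<in> A} \<in> \<phi>} \<in> \<phi>"
    and \<phi>0_sub: "\<phi>0 \<subseteq> \<phi>"
    using \<phi>A by (auto simp: \<A>_def shift_closed_def)
  obtain p where p: "set_filter S p" and sub: "\<phi> \<subseteq> p" and ultra: "\<And>A. A \<in> p \<or> - A \<in> p"
    using ex_ultra_set_filter[OF \<phi>] by blast
  note [simp] = set_filter_top[OF \<phi>] set_filter_top[OF p]
  \<comment> \<open>\<open>D A\<close> consists of those \<open>x\<close> for which \<open>A\<close>
    belongs to the translate of \<open>p\<close> by \<open>x\<close>.\<close>
  define D where "D A = {x. {y. f x y \<in> A} \<in> p}" for A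
  have D_mono: "D A \<subseteq> D B" if "A \<subseteq> B" for A B
    unfolding D_def by (rule Collect_mono, rule impI, erule set_filter_mono[OF p]) (use that in blast)
  have D_Int: "D A \<inter> D B \<subseteq> D (A \<inter> B)" for A B
    unfolding D_def using set_filter_Int[OF p] by (auto simp: Collect_conj_eq)
  have D_shift: "w \<in> S \<Longrightarrow> x \<in> S \<Longrightarrow> x \<in> D {y. f w y \<in> A} \<longleftrightarrow> f w x \<in> D A" for w x A
  proof -
    assume wx: "w \<in> S" "x \<in> S"
    \<comment> \<open>Associativity is known only on \<open>S\<close>, so the two sets are compared
      inside \<open>S\<close>, a member of \<open>p\<close>.\<close>
    have "{y. f w (f x y) \<in> A} \<inter> S = {y. f (f w x) y \<in> A} \<inter> S"
      using assoc wx by auto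
    then show ?thesis
      unfolding D_def mem_Collect_eq
      using set_filter_Int[OF p _ set_filter_top[OF p]] set_filter_mono[OF p]
      by (metis inf_le1)
  qed
  define \<rho> where "\<rho> = {A. D A \<in> \<phi>}"
  have "\<rho> = \<phi>"
  proof (rule max)
    show \<phi>\<rho>: "\<phi> \<subseteq> \<rho>"
    proof
      fix A assume "A \<in> \<phi>"
      then have "{x. {y. f x y \<in> A} \<in> \<phi>} \<in> \<phi>"
        by (rule \<phi>s)
      then show "A \<in> \<rho>"
        unfolding \<rho>_def D_def mem_Collect_eq
        by (rule set_filter_mono[OF \<phi>]) (use sub in blast)
    qed
    have "set_filter S \<rho>"
      unfolding set_filter_def
    proof (intro conjI ballI allI impI)
      show "S \<in> \<rho>"
        using \<phi>\<rho> by auto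
      have "D {} = {}"
        using set_filter_empty[OF p] by (simp add: D_def)
      then show "{} \<notin> \<rho>"
        using set_filter_empty[OF \<phi>] by (simp add: \<rho>_def)
      fix A B
      show "A \<inter> B \<in> \<rho>" if "A \<in> \<rho>" "B \<in> \<rho>"
        using that set_filter_mono[OF \<phi> _ D_Int] set_filter_Int[OF \<phi>] by (auto simp: \<rho>_def)
      show "B \<in> \<rho>" if "A \<in> \<rho>" "A \<subseteq> B"
        using that set_filter_mono[OF \<phi> _ D_mono] by (auto simp: \<rho>_def)
    qed
    moreover have "shift_closed f \<rho>"
      unfolding shift_closed_def
    proof
      fix A assume "A \<in> \<rho>"
      then have "D A \<in> \<phi>"
        by (simp add: \<rho>_def)
      then have "{w. {x. f w x \<in> D A} \<in> \<phi>} \<inter> S \<in> \<phi>"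
        using \<phi>s set_filter_Int[OF \<phi>] by simp
      moreover have "{w. {x. f w x \<in> D A} \<in> \<phi>} \<inter> S \<subseteq> {w. {y. f w y \<in> A} \<in> \<rho>}"
      proof clarsimp
        fix w assume w: "{x. f w x \<in> D A} \<in> \<phi>" "w \<in> S"
        have "{x. f w x \<in> D A} \<inter> S \<in> \<phi>"
          using w set_filter_Int[OF \<phi>] by simp
        then have "D {y. f w y \<in> A} \<in> \<phi>"
          by (rule set_filter_mono[OF \<phi>]) (use D_shift w in blast)
        then show "{y. f w y \<in> A} \<in> \<rho>"
          by (simp add: \<rho>_def)
      qed
      ultimately show "{w. {y. f w y \<in> A} \<in> \<rho>} \<in> \<rho>"
        using set_filter_mono[OF \<phi>] \<phi>\<rho> by blast
    qed
    ultimately show "\<rho> \<in> \<A>"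
      using \<phi>0_sub \<phi>\<rho> by (auto simp: \<A>_def)
  qed
  \<comment> \<open>An ultrafilter \<open>q\<close> extends \<open>\<psi>\<close> exactly if it
    extends \<open>\<phi>\<close> and the product of \<open>q\<close> and \<open>p\<close> is
    \<open>p\<close>.\<close>
  define \<psi> where "\<psi> = {B. \<exists>A\<in>p. \<exists>E\<in>\<phi>. E \<inter> D A \<subseteq> B}"
  have "\<psi> = \<phi>"
  proof (rule max)
    show \<phi>\<psi>: "\<phi> \<subseteq> \<psi>"
      unfolding \<psi>_def using set_filter_top[OF p] by blast
    have "set_filter S \<psi>"
      unfolding set_filter_def
    proof (intro conjI ballI allI impI)
      show "S \<in> \<psi>"
        using \<phi>\<psi> by auto
      show "{} \<notin> \<psi>"
      proof
        assume "{} \<in> \<psi>"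
        then obtain A E where A: "A \<in> p" and E: "E \<in> \<phi>" and "E \<inter> D A = {}"
          by (auto simp: \<psi>_def)
        \<comment> \<open>As \<open>p\<close> is an ultrafilter, outside \<open>D A\<close> means
          inside \<open>D (- A)\<close>; then \<open>\<rho> = \<phi>\<close> puts \<open>- A\<close>
          into \<open>p\<close>.\<close>
        have "x \<in> D (- A)" if "x \<in> E" for x
        proof -
          have "{y. f x y \<in> A} \<notin> p"
            using that \<open>E \<inter> D A = {}\<close> by (auto simp: D_def)
          then have "- {y. f x y \<in> A} \<in> p"
            using ultra by blast
          then show ?thesis
            by (simp add: D_def Compl_eq)
        qed
        then have "D (- A) \<in> \<phi>"
          using set_filter_mono[OF \<phi> E] by blast
        then have "- A \<in> p"
          using \<open>\<rho> = \<phi>\<close> sub by (auto simp: \<rho>_def)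
        then show False
          using set_filter_Int[OF p A, of "- A"] set_filter_empty[OF p] by simp
      qed
      fix B B'
      show "B \<inter> B' \<in> \<psi>" if "B \<in> \<psi>" "B' \<in> \<psi>"
      proof -
        obtain A E A' E' where AE: "A \<in> p" "E \<in> \<phi>" "E \<inter> D A \<subseteq> B" "A' \<in> p" "E' \<in> \<phi>" "E' \<inter> D A' \<subseteq> B'"
          using \<open>B \<in> \<psi>\<close> \<open>B' \<in> \<psi>\<close> by (auto simp: \<psi>_def)
        have "D (A \<inter> A') \<subseteq> D A \<inter> D A'"
          by (simp add: D_mono)
        then have "(E \<inter> E') \<inter> D (A \<inter> A') \<subseteq> B \<inter> B'"
          using AE by blast
        then show ?thesis
          unfolding \<psi>_def
          using set_filter_Int[OF \<phi> AE(2,5)] set_filter_Int[OF p AE(1,4)] by (intro CollectI bexI)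
      qed
      show "B' \<in> \<psi>" if "B \<in> \<psi>" "B \<subseteq> B'"
        using that unfolding \<psi>_def by blast
    qed
    moreover have "shift_closed f \<psi>"
      unfolding shift_closed_def
    proof
      fix B assume "B \<in> \<psi>"
      then obtain A E where A: "A \<in> p" and E: "E \<in> \<phi>" and B: "E \<inter> D A \<subseteq> B"
        by (auto simp: \<psi>_def)
      \<comment> \<open>For \<open>x \<in> D A\<close> the set \<open>{y. f x y \<in> A}\<close> is
        again in \<open>p\<close> and can take the place of \<open>A\<close>.\<close>
      have "({x. {y. f x y \<in> E} \<in> \<phi>} \<inter> S) \<inter> D A \<subseteq> {x. {y. f x y \<in> B} \<in> \<psi>}"
      proof clarsimp
        fix x assume x: "{y. f x y \<in> E} \<in> \<phi>" "x \<in> S" "x \<in> D A"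
        have "{y. f x y \<in> E} \<inter> S \<in> \<phi>"
          using x set_filter_Int[OF \<phi>] by simp
        moreover have "{y. f x y \<in> A} \<in> p"
          using x by (simp add: D_def)
        moreover have "({y. f x y \<in> E} \<inter> S) \<inter> D {y. f x y \<in> A} \<subseteq> {y. f x y \<in> B}"
          using B D_shift[OF x(2)] by blast
        ultimately show "{y. f x y \<in> B} \<in> \<psi>"
          unfolding \<psi>_def by blast
      qed
      moreover have "{x. {y. f x y \<in> E} \<in> \<phi>} \<inter> S \<in> \<phi>"
        using \<phi>s[OF E] set_filter_Int[OF \<phi>] by simp
      ultimately show "{x. {y. f x y \<in> B} \<in> \<psi>} \<in> \<psi>"
        unfolding \<psi>_def[of] using A by blast
    qed
    ultimately show "\<psi> \<in> \<A>"
      using \<phi>0_sub \<phi>\<psi> by (auto simp: \<A>_def)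
  qed
  \<comment> \<open>Since \<open>p\<close> extends \<open>\<psi>\<close>, it lies in its own
    stabilizer, which is idempotence.\<close>
  have "D A \<in> p" if "A \<in> p" for A
  proof -
    have "D A \<in> \<psi>"
      unfolding \<psi>_def using that set_filter_top[OF \<phi>] by blast
    then show ?thesis
      using \<open>\<psi> = \<phi>\<close> sub by blast
  qed
  then have "shift_closed f p"
    by (simp add: shift_closed_def D_def)
  then show ?thesis
    using p ultra \<phi>0_sub sub by (intro exI[of _ p]) simp
qed

section \<open>Locally compact Polish spaces and the ideal NC\<close>

lemma separable_metrizable_imp_second_countable:
  assumes "metrizable_space X" "separable_space X"
  shows "second_countable X"
proof -
  obtain M d where "Metric_space M d" and X: "X = Metric_space.mtopology M d"
    using assms(1) by (auto simp: metrizable_space_def)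
  interpret Metric_space M d by fact
  obtain D where D: "countable D" "D \<subseteq> M" "mtopology closure_of D = M"
    using assms(2) by (auto simp: separable_space_def X)
  define \<B> where "\<B> = (\<lambda>(x, n). mball x (inverse (real (Suc n)))) ` (D \<times> (UNIV :: nat set))"
  have "countable \<B>"
    unfolding \<B>_def using D(1) by (intro countable_image countable_SIGMA) auto
  moreover have "\<forall>V\<in>\<B>. openin X V"
    by (auto simp: \<B>_def X)
  moreover have "\<exists>V\<in>\<B>. x \<in> V \<and> V \<subseteq> U" if U: "openin X U" "x \<in> U" for U x
  proof -
    obtain r where r: "r > 0" "mball x r \<subseteq> U" and x: "x \<in> M"
      using U unfolding X openin_mtopology by blast
    obtain n where n: "inverse (real (Suc n)) < r / 2"
      using reals_Archimedean[of "r / 2"] r(1) by auto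
    have "x \<in> mtopology closure_of D"
      using x D by simp
    then obtain y where y: "y \<in> D" "y \<in> mball x (inverse (real (Suc n)))"
      using x by (meson centre_in_mball_iff in_closure_of inverse_positive_iff_positive
          of_nat_0_less_iff openin_mball zero_less_Suc)
    have "mball y (inverse (real (Suc n))) \<subseteq> mball x r"
      using y n by (intro mball_subset) (auto simp: commute)
    moreover have "x \<in> mball y (inverse (real (Suc n)))"
      using y x by (auto simp: commute)
    ultimately show ?thesis
      using y(1) r(2) by (intro bexI[of _ "mball y (inverse (real (Suc n)))"]) (auto simp: \<B>_def)
  qed
  ultimately show ?thesis
    unfolding second_countable_def by blast
qed

lemma second_countable_base_sequence:
  assumes "second_countable X"
  obtains U :: "nat \<Rightarrow> 'a set"
  where "\<And>n. openin X (U n)" "\<And>V x. openin X V \<Longrightarrow> x \<in> V \<Longrightarrow> \<exists>n. x \<in> U n \<and> U n \<subseteq> V"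
proof -
  obtain \<B> where \<B>: "countable \<B>" "\<forall>V\<in>\<B>. openin X V"
    "\<forall>V x. openin X V \<and> x \<in> V \<longrightarrow> (\<exists>W\<in>\<B>. x \<in> W \<and> W \<subseteq> V)"
    using assms by (auto simp: second_countable_def)
  \<comment> \<open>The empty set is added so that the enumerated family is nonempty.\<close>
  let ?U = "from_nat_into (insert {} \<B>)"
  have "range ?U = insert {} \<B>"
    using \<B>(1) by (intro range_from_nat_into) auto
  then have "?U n \<in> insert {} \<B>" for n
    by blast
  then have "openin X (?U n)" for n
    using \<B>(2) openin_empty[of X] by (metis insert_iff)
  moreover have "\<exists>n. x \<in> ?U n \<and> ?U n \<subseteq> V" if V: "openin X V" "x \<in> V" for V x
  proof -
    obtain W where "W \<in> \<B>" "x \<in> W" "W \<subseteq> V"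
      using \<B>(3)[rule_format, of V x] V by auto
    moreover have "W \<in> range ?U"
      using \<open>W \<in> \<B>\<close> \<open>range ?U = insert {} \<B>\<close> by simp
    ultimately show ?thesis
      by auto
  qed
  ultimately show thesis
    by (rule that)
qed

text \<open>Each new set contains the previous closure, one more compact piece of a countable cover,
  and a point outside that closure. The point exists by non-compactness; the resulting strict
  inclusions later leave points in the gaps.\<close>

lemma compact_exhaustion:
  assumes "Hausdorff_space X" "locally_compact_space X" "second_countable X" "\<not> compact_space X"
  obtains U :: "nat \<Rightarrow> 'a set"
  where "\<And>n. openin X (U n)" "\<And>n. compactin X (X closure_of U n)"
    "\<And>n. X closure_of U n \<subset> U (Suc n)" "(\<Union>n. U n) = topspace X"
proof -
  obtain V where V: "\<And>n. openin X (V n)"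
    "\<And>W x. openin X W \<Longrightarrow> x \<in> W \<Longrightarrow> \<exists>n::nat. x \<in> V n \<and> V n \<subseteq> W"
    using second_countable_base_sequence[OF assms(3)] by blast
  \<comment> \<open>By local compactness the basic sets with compact closure already cover the
    space.\<close>
  define V' where "V' n = (if compactin X (X closure_of V n) then X closure_of V n else {})" for n
  have V'_compact: "compactin X (V' n)" for n
    by (simp add: V'_def)
  let ?P = "\<lambda>_ U. openin X U \<and> compactin X (X closure_of U)"
  let ?Q = "\<lambda>n U W. X closure_of U \<subset> W \<and> V' n \<subseteq> W"
  have step: "\<exists>W. ?P (Suc n) W \<and> ?Q n U W" if U: "?P n U" for n U
  proof -
    have "X closure_of U \<noteq> topspace X"
      using U assms(4) by (auto simp: compact_space_def)
    then obtain x where x: "x \<in> topspace X" "x \<notin> X closure_of U"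
      using closure_of_subset_topspace[of X U] by blast
    have "compactin X (X closure_of U \<union> V' n \<union> {x})"
      using U V'_compact x by (intro compactin_Un) auto
    then obtain W L where W: "openin X W" "compactin X L" "closedin X L"
      "X closure_of U \<union> V' n \<union> {x} \<subseteq> W" "W \<subseteq> L"
      using locally_compact_space_compact_closed_compact[of X] assms(1,2) by blast
    have "compactin X (X closure_of W)"
      using W closure_of_minimal closed_compactin by (metis closedin_closure_of)
    then show ?thesis
      using W x by (intro exI[of _ W]) auto
  qed
  have "\<exists>U. \<forall>n. ?P n (U n) \<and> ?Q n (U n) (U (Suc n))"
    by (rule dependent_nat_choice[of ?P ?Q]) (use step in \<open>auto intro!: exI[of _ "{}"]\<close>)
  then obtain U where U: "\<And>n. ?P n (U n) \<and> ?Q n (U n) (U (Suc n))"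
    by blast
  have "x \<in> (\<Union>n. U n)" if x: "x \<in> topspace X" for x
  proof -
    obtain W where W: "openin X W" "compactin X (X closure_of W)" "x \<in> W"
      using locally_compact_space_compact_closure_of[of X] x assms(1,2) by auto
    obtain n where n: "x \<in> V n" "V n \<subseteq> W"
      using V(2) W by blast
    have "compactin X (X closure_of V n)"
      using n W by (meson closed_compactin closedin_closure_of closure_of_mono)
    moreover have "x \<in> X closure_of V n"
      using closure_of_subset[OF openin_subset[OF V(1)]] n(1) by (rule subsetD)
    ultimately have "x \<in> V' n"
      by (simp add: V'_def)
    then show ?thesis
      using U by blast
  qed
  moreover have "U n \<subseteq> topspace X" for n
    using U[of n] by (simp add: openin_subset)
  ultimately have "(\<Union>n. U n) = topspace X"
    by blast
  show thesis
  proof (rule that)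
    show "openin X (U n)" "compactin X (X closure_of U n)" "X closure_of U n \<subset> U (Suc n)" for n
      using U[of n] by simp_all
  qed fact
qed

lemma compactin_subset_increasing_open_cover:
  assumes "compactin X K" "\<And>n. openin X (U n)" "\<And>n. U n \<subseteq> U (Suc n)" "K \<subseteq> (\<Union>n. U n)"
  obtains n :: nat where "K \<subseteq> U n"
proof -
  have "\<exists>\<F>. finite \<F> \<and> \<F> \<subseteq> range U \<and> K \<subseteq> \<Union>\<F>"
    by (rule compactinD[OF assms(1)]) (use assms(2,4) in auto)
  then obtain \<F> where \<F>: "finite \<F>" "\<F> \<subseteq> range U" "K \<subseteq> \<Union>\<F>"
    by (elim exE conjE)
  obtain I where I: "finite I" "\<F> = U ` I"
    using finite_subset_image[OF \<F>(1,2)] by blast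
  have mono: "U i \<subseteq> U j" if "i \<le> j" for i j
    using lift_Suc_mono_le[of U i j] assms(3) that by simp
  \<comment> \<open>Inserting 0 covers the case of an empty subcover.\<close>
  have "K \<subseteq> U (Max (insert 0 I))"
  proof
    fix x assume "x \<in> K"
    then obtain i where "i \<in> I" "x \<in> U i"
      using \<F> I by auto
    moreover from this have "i \<le> Max (insert 0 I)"
      using I by auto
    ultimately show "x \<in> U (Max (insert 0 I))"
      using mono by blast
  qed
  then show thesis
    by (rule that)
qed

text \<open>Removing from \<open>U n\<close> the finitely many other points of \<open>B\<close>
  leaves a neighborhood that meets \<open>B\<close> in at most the given point; this yields
  closedness and discreteness together.\<close>

lemma closed_discrete_in_locally_finite:
  assumes "t1_space X" "B \<subseteq> topspace X"
    and cover: "topspace X \<subseteq> (\<Union>n. U n)"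
    and "\<And>n. openin X (U n)" "\<And>n. finite (B \<inter> U n)"
  shows "closed_discrete_in X B"
proof -
  have sub: "\<exists>V. openin X V \<and> x \<in> V \<and> V \<inter> A \<subseteq> {x}" if "A \<subseteq> B" "x \<in> topspace X" for x A
  proof -
    obtain n where n: "x \<in> U n"
      using \<open>x \<in> topspace X\<close> cover by blast
    let ?F = "B \<inter> U n - {x}"
    have "closedin X ?F"
      using assms(1,2,5) by (intro t1_space_closedin_finite[THEN iffD1, rule_format]) auto
    then have "openin X (U n - ?F)"
      using assms(4) by (simp add: openin_diff)
    moreover have "x \<in> U n - ?F" "(U n - ?F) \<inter> A \<subseteq> {x}"
      using n \<open>A \<subseteq> B\<close> by auto
    ultimately show ?thesis
      by blast
  qed
  have "openin X (topspace X - B)"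
  proof (subst openin_subopen, intro ballI)
    fix x assume x: "x \<in> topspace X - B"
    then obtain V where "openin X V" "x \<in> V" "V \<inter> B \<subseteq> {x}"
      using sub[of B x] by blast
    then show "\<exists>T. openin X T \<and> x \<in> T \<and> T \<subseteq> topspace X - B"
      using x openin_subset[of X V] by (intro exI[of _ V]) blast
  qed
  then have "closedin X B"
    using assms(2) by (simp add: closedin_def)
  moreover have "openin (subtopology X B) {x}" if x: "x \<in> B" for x
  proof -
    obtain V where "openin X V" "x \<in> V" "V \<inter> B \<subseteq> {x}"
      using sub[of B x] x assms(2) by blast
    then show ?thesis
      unfolding openin_subtopology using x by (intro exI[of _ V]) auto
  qed
  then have "discrete_topology B = subtopology X B"
    using assms(2) by (subst discrete_topology_unique) auto
  ultimately show ?thesis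
    by (simp add: closed_discrete_in_def)
qed

section \<open>Density in an open set, tested on nonempty open subsets\<close>

lemma dense_in_openD:
  assumes "dense_in_open X E Q" "openin X V" "V \<subseteq> Q" "V \<noteq> {}"
  shows "E \<inter> V \<noteq> {}"
proof -
  obtain x where x: "x \<in> V"
    using assms(4) by blast
  have "x \<in> subtopology X Q closure_of (E \<inter> Q)"
    using assms(1,3) x by (auto simp: dense_in_open_def)
  moreover have "openin (subtopology X Q) V"
    using assms(2,3) by (metis inf.absorb_iff2 openin_subtopology_Int2)
  ultimately show ?thesis
    using x by (auto simp: in_closure_of)
qed

lemma dense_in_openI:
  assumes "openin X Q" "\<And>V. openin X V \<Longrightarrow> V \<subseteq> Q \<Longrightarrow> V \<noteq> {} \<Longrightarrow> E \<inter> V \<noteq> {}"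
  shows "dense_in_open X E Q"
proof -
  have sub: "Q \<subseteq> topspace X"
    using assms(1) by (rule openin_subset)
  have "x \<in> subtopology X Q closure_of (E \<inter> Q)" if "x \<in> Q" for x
    unfolding in_closure_of
  proof (intro conjI allI impI)
    show "x \<in> topspace (subtopology X Q)"
      using that sub by auto
    fix T assume T: "x \<in> T \<and> openin (subtopology X Q) T"
    then have "openin X T" "T \<subseteq> Q"
      using openin_trans_full[OF _ assms(1), of T] openin_subset[of "subtopology X Q" T] by auto
    then show "\<exists>y. y \<in> E \<inter> Q \<and> y \<in> T"
      using assms(2)[of T] T by blast
  qed
  moreover have "subtopology X Q closure_of (E \<inter> Q) \<subseteq> Q"
    using closure_of_subset_topspace[of "subtopology X Q"] by auto
  ultimately show ?thesis
    using assms(1) by (auto simp: dense_in_open_def)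
qed

section \<open>Closure properties of the ideal \<open>NC X\<close>\<close>

lemma NC_subset: "A \<in> NC X \<Longrightarrow> B \<subseteq> A \<Longrightarrow> B \<in> NC X"
  unfolding NC_def by blast

lemma compactin_imp_NC:
  assumes "compactin X K"
  shows "K \<in> NC X"
proof -
  have "nowhere_dense_in X {}"
    by (simp add: nowhere_dense_in_def)
  then show ?thesis
    using assms unfolding NC_def by blast
qed

lemma NC_Un:
  assumes "A \<in> NC X" "B \<in> NC X"
  shows "A \<union> B \<in> NC X"
proof -
  obtain K M L N where "compactin X K" "nowhere_dense_in X M" "A \<subseteq> K \<union> M"
    "compactin X L" "nowhere_dense_in X N" "B \<subseteq> L \<union> N"
    using assms unfolding NC_def by blast
  then have "compactin X (K \<union> L)" "nowhere_dense_in X (M \<union> N)" "A \<union> B \<subseteq> (K \<union> L) \<union> (M \<union> N)"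
    using compactin_Un nowhere_dense_in_Un by blast+
  then show ?thesis
    unfolding NC_def by blast
qed

lemma NC_Union_finite:
  assumes "finite \<F>" "\<F> \<subseteq> NC X"
  shows "\<Union>\<F> \<in> NC X"
  using assms by (induction \<F> rule: finite_induct) (auto intro: NC_Un compactin_imp_NC)

lemma finite_imp_NC: "finite A \<Longrightarrow> A \<subseteq> topspace X \<Longrightarrow> A \<in> NC X"
  by (simp add: compactin_imp_NC finite_imp_compactin)

text \<open>Compact sets are closed, and closures of nowhere dense sets stay nowhere dense. Avoiding
  a closed superset is an open condition.\<close>

lemma NC_subset_closedin:
  assumes "Hausdorff_space X" "A \<in> NC X"
  obtains B where "A \<subseteq> B" "closedin X B" "B \<in> NC X"
proof -
  obtain K N where K: "compactin X K" and N: "nowhere_dense_in X N" and A: "A \<subseteq> K \<union> N"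
    using assms(2) by (auto simp: NC_def)
  have "nowhere_dense_in X (X closure_of N)"
    using N by (simp add: nowhere_dense_in_def closure_of_subset_topspace)
  then have "K \<union> X closure_of N \<in> NC X"
    using K by (auto simp: NC_def)
  moreover have "A \<subseteq> K \<union> X closure_of N"
    using A N closure_of_subset[of N X] by (auto simp: nowhere_dense_in_def)
  moreover have "closedin X (K \<union> X closure_of N)"
    using K assms(1) by (simp add: closedin_Un compactin_imp_closedin)
  ultimately show thesis
    using that by blast
qed

text \<open>If \<open>V \<subseteq> K \<union> N\<close>, then \<open>V - K\<close> is open and
  inside the closure of the nowhere dense \<open>N\<close>, hence empty, so
  \<open>V \<subseteq> K\<close>.\<close>

lemma NC_openin_iff:
  assumes "Hausdorff_space X" "openin X V"
  shows "V \<in> NC X \<longleftrightarrow> compactin X (X closure_of V)"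
proof
  assume "V \<in> NC X"
  then obtain K N where K: "compactin X K" and N: "nowhere_dense_in X N" and V: "V \<subseteq> K \<union> N"
    by (auto simp: NC_def)
  have cl: "closedin X K"
    using K assms(1) by (simp add: compactin_imp_closedin)
  have "V - K \<subseteq> X closure_of N"
    using V N closure_of_subset[of N X] by (auto simp: nowhere_dense_in_def)
  moreover have "openin X (V - K)"
    using assms(2) cl by (simp add: openin_diff)
  ultimately have "V \<subseteq> K"
    using N interior_of_maximal[of "V - K" "X closure_of N" X] by (auto simp: nowhere_dense_in_def)
  then show "compactin X (X closure_of V)"
    using K cl by (meson closed_compactin closedin_closure_of closure_of_minimal)
next
  assume "compactin X (X closure_of V)"
  then show "V \<in> NC X"
    using NC_subset[OF compactin_imp_NC] closure_of_subset[OF openin_subset[OF assms(2)]] by blast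
qed

text \<open>
  A set outside \<open>NC X\<close> differs from its trace on the interior of its closure by a nowhere dense
  set, so that interior cannot have compact closure.
\<close>

lemma not_NC_imp_interior_closure_noncompact:
  assumes "A \<subseteq> topspace X" "A \<notin> NC X"
  defines "W \<equiv> X interior_of (X closure_of A)"
  shows "\<not> compactin X (X closure_of W)"
proof
  assume comp: "compactin X (X closure_of W)"
  have "nowhere_dense_in X (X closure_of A - W)"
  proof -
    have "closedin X (X closure_of A - W)"
      by (simp add: W_def closedin_diff)
    moreover have "X interior_of (X closure_of A - W) \<subseteq> W"
      unfolding W_def by (intro interior_of_mono) auto
    moreover have "X interior_of (X closure_of A - W) \<subseteq> X closure_of A - W"
      by (rule interior_of_subset)
    ultimately show ?thesis
      using closure_of_subset_topspace[of X A]
      by (auto simp: nowhere_dense_in_def closure_of_closedin)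
  qed
  moreover have "W \<subseteq> X closure_of W"
    by (simp add: W_def closure_of_subset interior_of_subset_topspace)
  moreover have "A \<subseteq> X closure_of A"
    using assms(1) by (rule closure_of_subset)
  ultimately have "A \<in> NC X"
    unfolding NC_def using comp by blast
  then show False
    using assms(2) by simp
qed

lemma NC_homeomorphic_image:
  assumes "homeomorphic_map X X h" "A \<in> NC X"
  shows "h ` A \<in> NC X"
proof -
  obtain K N where K: "compactin X K" and N: "nowhere_dense_in X N" and A: "A \<subseteq> K \<union> N"
    using assms(2) by (auto simp: NC_def)
  have "compactin X (h ` K)"
    by (rule image_compactin[OF K homeomorphic_imp_continuous_map[OF assms(1)]])
  moreover have "nowhere_dense_in X (h ` N)"
  proof -
    have "X interior_of (X closure_of (h ` N)) = h ` (X interior_of (X closure_of N))"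
      using assms(1) N
      by (simp add: nowhere_dense_in_def homeomorphic_map_closure_of homeomorphic_map_interior_of
          closure_of_subset_topspace)
    moreover have "h ` N \<subseteq> topspace X"
      using N homeomorphic_imp_surjective_map[OF assms(1)] by (auto simp: nowhere_dense_in_def)
    ultimately show ?thesis
      using N by (simp add: nowhere_dense_in_def)
  qed
  ultimately show ?thesis
    unfolding NC_def using A by blast
qed

section \<open>Disjoint sequences with monochromatic products\<close>

text \<open>In a fixed row the code grows with the second coordinate, so each sequence gets its
  terms in the order of their indices.\<close>

lemma prod_encode_less_iff [simp]: "prod_encode (i, m) < prod_encode (i, n) \<longleftrightarrow> m < n"
proof -
  have "strict_mono (\<lambda>k. prod_encode (i, k))"
    by (simp add: strict_mono_Suc_iff prod_encode_def)
  then show ?thesis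
    by (rule strict_mono_less)
qed

lemma (in monoid) foldr_mult_right:
  assumes "set xs \<subseteq> carrier G" "y \<in> carrier G"
  shows "foldr (\<lambda>x y. x \<otimes> y) xs \<one> \<in> carrier G"
    and "foldr (\<lambda>x y. x \<otimes> y) xs y = foldr (\<lambda>x y. x \<otimes> y) xs \<one> \<otimes> y"
  using assms by (induction xs) (auto simp: m_assoc)

text \<open>One-element lists recover the single terms, which merges the two parts of
  \<open>FS\<close>.\<close>

lemma (in monoid) FS_eq_foldr:
  assumes "range a \<subseteq> carrier G"
  shows "FS G a = {foldr (\<lambda>x y. x \<otimes> y) (map a ns) \<one> | ns. ns \<noteq> [] \<and> sorted_wrt (<) ns}"
    (is "_ = ?R")
proof
  have a: "a n \<in> carrier G" for n
    using assms by blast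
  have "a n \<in> ?R" for n
    by (intro CollectI exI[of _ "[n]"]) (simp add: a)
  moreover have "foldr (\<lambda>x y. x \<otimes> y) (map a ns) \<one> \<in> ?R" if "2 \<le> length ns" "sorted_wrt (<) ns" for ns
    using that by (intro CollectI exI[of _ ns]) auto
  ultimately show "FS G a \<subseteq> ?R"
    unfolding FS_def by blast
  have "foldr (\<lambda>x y. x \<otimes> y) (map a ns) \<one> \<in> FS G a" if ns: "ns \<noteq> []" "sorted_wrt (<) ns" for ns
  proof (cases "2 \<le> length ns")
    case True
    then show ?thesis
      unfolding FS_def using ns by blast
  next
    case False
    then obtain n where "ns = [n]"
      using ns(1) by (cases ns rule: remdups_adj.cases) auto
    then have "foldr (\<lambda>x y. x \<otimes> y) (map a ns) \<one> = a n"
      by (simp add: a)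
    then show ?thesis
      by (simp add: FS_def)
  qed
  then show "?R \<subseteq> FS G a"
    by blast
qed

text \<open>
  A single sequence \<open>z\<close> stores countably many sequences: its entry at \<open>prod_encode (i, k)\<close> is the
  \<open>k\<close>-th term of the \<open>i\<close>-th sequence. The set \<open>prods G z i t\<close> consists of the products of the
  \<open>i\<close>-th sequence that use only entries of \<open>z\<close> before \<open>t\<close>.
\<close>

primrec prods :: "('a, 'b) monoid_scheme \<Rightarrow> (nat \<Rightarrow> 'a) \<Rightarrow> nat \<Rightarrow> nat \<Rightarrow> 'a set" where
  "prods G z i 0 = {}"
| "prods G z i (Suc t) =
     (if fst (prod_decode t) = i
      then prods G z i t \<union> (\<lambda>y. y \<otimes>\<^bsub>G\<^esub> z t) ` insert \<one>\<^bsub>G\<^esub> (prods G z i t)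
      else prods G z i t)"

lemma prods_mono: "s \<le> t \<Longrightarrow> prods G z i s \<subseteq> prods G z i t"
  by (rule lift_Suc_mono_le) auto

lemma prods_cong: "(\<And>s. s < t \<Longrightarrow> f s = g s) \<Longrightarrow> prods G f i t = prods G g i t"
  by (induction t) auto

text \<open>Whatever \<open>i\<close> is, stage \<open>t\<close> adds only \<open>z t\<close> and
  its products with earlier elements, so the whole union grows by a finite set.\<close>

lemma finite_Union_prods: "finite (\<Union>i. prods G z i t)"
proof (induction t)
  case (Suc t)
  let ?V = "\<Union>i. prods G z i t"
  have "(\<Union>i. prods G z i (Suc t)) \<subseteq> ?V \<union> (\<lambda>y. y \<otimes>\<^bsub>G\<^esub> z t) ` insert \<one>\<^bsub>G\<^esub> ?V"
    by (auto split: if_splits)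
  then show ?case
    using Suc by (meson finite_Un finite_imageI finite_insert finite_subset)
qed simp

text \<open>Splitting off the last factor matches the recursion: products with last index
  \<open>k\<close> arise at stage \<open>prod_encode (i, k)\<close>.\<close>

lemma (in monoid) prods_eq_foldr:
  assumes z: "range z \<subseteq> carrier G"
  defines "a \<equiv> \<lambda>i k. z (prod_encode (i, k))"
  shows "prods G z i t = {foldr (\<lambda>x y. x \<otimes> y) (map (a i) ns) \<one> | ns.
    ns \<noteq> [] \<and> sorted_wrt (<) ns \<and> (\<forall>n\<in>set ns. prod_encode (i, n) < t)}" (is "_ = ?R t")
proof (induction t)
  case 0
  show ?case
    by auto
next
  case (Suc t)
  have za: "a i k \<in> carrier G" for k
    using z by (auto simp: a_def)
  have snoc: "foldr (\<lambda>x y. x \<otimes> y) (map (a i) (ms @ [k])) \<one> =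
      foldr (\<lambda>x y. x \<otimes> y) (map (a i) ms) \<one> \<otimes> a i k" for ms k
    using za foldr_mult_right(2)[of "map (a i) ms" "a i k"] by (simp add: image_subset_iff)
  show ?case
  proof (cases "fst (prod_decode t) = i")
    case False
    then have "prod_encode (i, n) \<noteq> t" for n
      by auto
    then have "prod_encode (i, n) < Suc t \<longleftrightarrow> prod_encode (i, n) < t" for n
      using less_Suc_eq by auto
    then have "?R (Suc t) = ?R t"
      by simp
    then show ?thesis
      using False Suc by simp
  next
    case True
    then obtain k where k: "t = prod_encode (i, k)"
      by (metis prod.collapse prod_decode_inverse)
    have zt: "z t = a i k"
      by (simp add: k a_def)
    have "?R (Suc t) = ?R t \<union> (\<lambda>y. y \<otimes> z t) ` insert \<one> (?R t)" (is "_ = ?R'")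
    proof
      show "?R (Suc t) \<subseteq> ?R'"
      proof
        fix x assume "x \<in> ?R (Suc t)"
        then obtain ns where ns: "ns \<noteq> []" "sorted_wrt (<) ns" "\<forall>n\<in>set ns. prod_encode (i, n) < Suc t"
          and x: "x = foldr (\<lambda>x y. x \<otimes> y) (map (a i) ns) \<one>"
          by blast
        obtain ms l where ml: "ns = ms @ [l]"
          using ns(1) by (metis append_butlast_last_id)
        have less: "\<forall>n\<in>set ms. n < l" and sorted: "sorted_wrt (<) ms"
          using ns(2) by (auto simp: ml sorted_wrt_append)
        have lk: "l \<le> k"
          using ns(3) prod_encode_less_iff[of i k l] by (simp add: ml k del: prod_encode_less_iff)
        show "x \<in> ?R'"
        proof (cases "l = k")
          case True
          have x': "x = foldr (\<lambda>x y. x \<otimes> y) (map (a i) ms) \<one> \<otimes> z t"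
            using x snoc[of ms l] by (simp add: ml True zt)
          \<comment> \<open>The inserted unit accounts for the product that consists of
            \<open>z t\<close> alone.\<close>
          have "foldr (\<lambda>x y. x \<otimes> y) (map (a i) ms) \<one> \<in> insert \<one> (?R t)"
          proof (cases "ms = []")
            case False
            then show ?thesis
              using less sorted True by (auto simp: k)
          qed simp
          then show ?thesis
            using x' by blast
        next
          case False
          then have "\<forall>n\<in>set ns. prod_encode (i, n) < t"
            using lk less by (auto simp: ml k)
          then show ?thesis
            using ns x by blast
        qed
      qed
      show "?R' \<subseteq> ?R (Suc t)"
      proof -
        have "?R t \<subseteq> ?R (Suc t)"
          using less_SucI by blast
        moreover have "\<one> \<otimes> z t \<in> ?R (Suc t)"
          using zt za by (intro CollectI exI[of _ "[k]"]) (simp add: k)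
        moreover have "foldr (\<lambda>x y. x \<otimes> y) (map (a i) ms) \<one> \<otimes> z t \<in> ?R (Suc t)"
          if ms: "ms \<noteq> []" "sorted_wrt (<) ms" "\<forall>n\<in>set ms. prod_encode (i, n) < t" for ms
        proof -
          have "sorted_wrt (<) (ms @ [k])"
            using ms by (auto simp: sorted_wrt_append k)
          moreover have "\<forall>n\<in>set (ms @ [k]). prod_encode (i, n) < Suc t"
            using ms by (auto simp: k less_Suc_eq)
          ultimately show ?thesis
            using snoc[of ms k] unfolding zt by (intro CollectI exI[of _ "ms @ [k]"]) auto
        qed
        ultimately show ?thesis
          by blast
      qed
    qed
    then show ?thesis
      using True Suc by simp
  qed
qed

lemma (in monoid) FS_eq_Union_prods:
  assumes z: "range z \<subseteq> carrier G"
  shows "FS G (\<lambda>k. z (prod_encode (i, k))) = (\<Union>t. prods G z i t)"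
proof -
  have bound: "\<exists>t. \<forall>n\<in>set ns. prod_encode (i, n) < t" for ns
    using finite_nat_set_iff_bounded[of "(\<lambda>n. prod_encode (i, n)) ` set ns"] by auto
  have "range (\<lambda>k. z (prod_encode (i, k))) \<subseteq> carrier G"
    using z by auto
  then show ?thesis
    unfolding prods_eq_foldr[OF z] FS_eq_foldr[OF \<open>range (\<lambda>k. z (prod_encode (i, k))) \<subseteq> carrier G\<close>]
    using bound by blast
qed

section \<open>Large sets of starting points and Galvin's recursion\<close>

lemma set_filter_finite_INT:
  assumes "set_filter S p" "finite I" "\<And>i. i \<in> I \<Longrightarrow> A i \<in> p"
  shows "S \<inter> (\<Inter>i\<in>I. A i) \<in> p"
  using assms(2,3)
proof (induction I rule: finite_induct)
  case (insert i I)
  then have "(S \<inter> (\<Inter>i\<in>I. A i)) \<inter> A i \<in> p"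
    by (simp add: set_filter_Int[OF assms(1)])
  then show ?case
    by (simp add: Int_ac)
qed (simp add: set_filter_top[OF assms(1)])

lemma set_filter_ex_member:
  assumes "set_filter S p" "A \<in> p"
  obtains x where "x \<in> A"
  using assms set_filter_empty by (metis all_not_in_conv)

text \<open>The set of those \<open>x \<in> M\<close> which can start a sequence with all products in \<open>M\<close>.\<close>

definition (in monoid) starters :: "'a set set \<Rightarrow> 'a set \<Rightarrow> 'a set" where
  "starters p M = {x \<in> M. {y. x \<otimes> y \<in> M} \<in> p}"

lemma (in monoid) starters_mem:
  assumes "set_filter S p" "shift_closed (\<lambda>x y. x \<otimes> y) p" "M \<in> p"
  shows "starters p M \<in> p"
proof -
  have "M \<inter> {x. {y. x \<otimes> y \<in> M} \<in> p} \<in> p"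
    using assms by (intro set_filter_Int[OF assms(1)]) (auto simp: shift_closed_def)
  then show ?thesis
    by (simp add: starters_def Int_def)
qed

text \<open>Let \<open>E = {y. x \<otimes> y \<in> M}\<close>. For \<open>y \<in> S\<close> in
  \<open>starters p E\<close>, associativity shows that \<open>x \<otimes> y\<close> is again in
  \<open>starters p M\<close>. This invariance lets a sequence be continued forever.\<close>

lemma (in monoid) starters_shift:
  assumes p: "set_filter S p" "shift_closed (\<lambda>x y. x \<otimes> y) p" and S: "S \<subseteq> carrier G"
    and x: "x \<in> starters p M" "x \<in> S"
  shows "{y. x \<otimes> y \<in> starters p M} \<in> p"
proof -
  define E where "E = {y. x \<otimes> y \<in> M}"
  have E: "E \<in> p"
    using x by (simp add: starters_def E_def)
  then have "E \<inter> {y. {z. y \<otimes> z \<in> E} \<in> p} \<inter> S \<in> p"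
    using p(2) by (intro set_filter_Int[OF p(1)] set_filter_top[OF p(1)]) (auto simp: shift_closed_def)
  moreover have "{z. (x \<otimes> y) \<otimes> z \<in> M} \<in> p" if y: "{z. y \<otimes> z \<in> E} \<in> p" "y \<in> S" for y
  proof -
    have "{z. y \<otimes> z \<in> E} \<inter> S \<in> p"
      using y by (intro set_filter_Int[OF p(1)] set_filter_top[OF p(1)])
    moreover have "{z. y \<otimes> z \<in> E} \<inter> S \<subseteq> {z. (x \<otimes> y) \<otimes> z \<in> M}"
      using x(2) y(2) S by (auto simp: E_def m_assoc subset_iff)
    ultimately show ?thesis
      by (rule set_filter_mono[OF p(1)])
  qed
  ultimately show ?thesis
    by (elim set_filter_mono[OF p(1)]) (auto simp: starters_def E_def)
qed

text \<open>One recursion builds all sequences at once. Before each stage only finitely many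
  products exist, so disjointness excludes only finite sets, and the first term of each sequence can
  be aimed at a prescribed \<open>U i\<close>.\<close>

lemma (in group) ex_disjoint_FS_sequences:
  fixes N U :: "nat \<Rightarrow> 'a set"
  assumes p: "set_filter S p" "shift_closed (\<lambda>x y. x \<otimes> y) p" and S: "S \<subseteq> carrier G"
    and M: "M \<in> p" "M \<subseteq> S"
    and N: "\<And>t. S - N t \<in> p" and finite: "\<forall>F. finite F \<longrightarrow> S - F \<in> p"
  shows "\<exists>z. range z \<subseteq> M \<and> inj z \<and>
    (\<forall>i t. prods G z i t \<subseteq> M) \<and>
    (\<forall>i j s t. i \<noteq> j \<longrightarrow> prods G z i s \<inter> prods G z j t = {}) \<and>
    (\<forall>t. prods G z (fst (prod_decode t)) t \<noteq> {} \<longrightarrow> z t \<notin> N t) \<and>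
    (\<forall>i. U i \<inter> starters p M \<noteq> {} \<longrightarrow> U i \<inter> (\<Union>j t. prods G z j t) \<noteq> {})"
proof -
  have fin: "S - F \<in> p" if "finite F" for F
    using finite that by blast
  define M' where "M' = starters p M"
  have M': "M' \<in> p" "M' \<subseteq> M"
    using starters_mem[OF p M(1)] by (auto simp: M'_def starters_def)
  define used where "used z t = (\<Union>i. prods G z i t)" for z t
  have finite_used: "finite (used z t)" for z t
    unfolding used_def by (rule finite_Union_prods)
  \<comment> \<open>Admissible choices at stage \<open>t\<close>: new products are fresh and stay in
    \<open>M'\<close>. Later terms avoid \<open>N t\<close>; a first term is instead taken from
    \<open>U i\<close> if a fresh point of \<open>U i \<inter> M'\<close> exists.\<close>
  define P where "P z t r \<longleftrightarrow> r \<in> S \<and>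
      (\<forall>y\<in>insert \<one> (prods G z (fst (prod_decode t)) t). y \<otimes> r \<in> M' - used z t) \<and>
      (prods G z (fst (prod_decode t)) t \<noteq> {} \<longrightarrow> r \<notin> N t) \<and>
      (prods G z (fst (prod_decode t)) t = {} \<longrightarrow> \<not> U (fst (prod_decode t)) \<inter> M' \<subseteq> used z t \<longrightarrow>
        r \<in> U (fst (prod_decode t)))" for z t r
  have prods_M': "prods G z i t \<subseteq> M'" if "\<And>s. s < t \<Longrightarrow> P z s (z s)" for z i t
    using that
  proof (induction t)
    case (Suc t)
    then have "prods G z i t \<subseteq> M'"
      by simp
    then show ?case
      using Suc.prems[of t] by (auto simp: P_def)
  qed simp
  have ex: "\<exists>r. P z t r" if IH: "\<And>s. s < t \<Longrightarrow> P z s (z s)" for z t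
  proof -
    define T where "T = prods G z (fst (prod_decode t)) t"
    have T: "T \<subseteq> M'" "finite T"
      using prods_M'[OF IH] finite_used[of z t]
      by (auto simp: T_def used_def intro: finite_subset[rotated])
    have M'_used: "M' \<inter> (S - used z t) \<in> p"
      using M'(1) fin[OF finite_used] by (rule set_filter_Int[OF p(1)])
    show ?thesis
    proof (cases "T = {}")
      case True
      show ?thesis
      \<comment> \<open>If \<open>U i \<inter> M'\<close> is used up, its points already are
        products, and any fresh point of \<open>M'\<close> will do.\<close>
      proof (cases "U (fst (prod_decode t)) \<inter> M' \<subseteq> used z t")
        case True
        obtain r where "r \<in> M' \<inter> (S - used z t)"
          using set_filter_ex_member[OF p(1) M'_used] .
        then show ?thesis
          using True \<open>T = {}\<close> S by (intro exI[of _ r]) (auto simp: P_def T_def subset_iff)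
      next
        case False
        then obtain r where "r \<in> U (fst (prod_decode t))" "r \<in> M'" "r \<notin> used z t"
          by blast
        then show ?thesis
          using \<open>T = {}\<close> S M' M(2) by (intro exI[of _ r]) (auto simp: P_def T_def subset_iff)
      qed
    next
      case False
      have "{r. y \<otimes> r \<in> M' - used z t} \<in> p" if y: "y \<in> T" for y
      proof -
        have yS: "y \<in> S" and yc: "y \<in> carrier G"
          using y T M' M S by auto
        \<comment> \<open>By cancellation each used element excludes at most one
          \<open>r\<close>.\<close>
        have "inj_on (\<lambda>r. y \<otimes> r) {r \<in> S. y \<otimes> r \<in> used z t}"
          using yc S by (auto intro!: inj_onI simp: subset_iff)
        moreover have "finite ((\<lambda>r. y \<otimes> r) ` {r \<in> S. y \<otimes> r \<in> used z t})"
          by (rule finite_subset[OF _ finite_used[of z t]]) auto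
        ultimately have "finite {r \<in> S. y \<otimes> r \<in> used z t}"
          using finite_imageD by blast
        then have "{r. y \<otimes> r \<in> M'} \<inter> (S - {r \<in> S. y \<otimes> r \<in> used z t}) \<in> p"
          using starters_shift[OF p S] y T yS fin
          by (intro set_filter_Int[OF p(1)]) (auto simp: M'_def)
        then show ?thesis
          by (rule set_filter_mono[OF p(1)]) auto
      qed
      then have "S \<inter> (\<Inter>y\<in>T. {r. y \<otimes> r \<in> M' - used z t}) \<in> p"
        by (rule set_filter_finite_INT[OF p(1) T(2)])
      then have "(S \<inter> (\<Inter>y\<in>T. {r. y \<otimes> r \<in> M' - used z t})) \<inter> (M' \<inter> (S - used z t)) \<inter> (S - N t) \<in> p"
        using set_filter_Int[OF p(1) set_filter_Int[OF p(1) _ M'_used] N] by blast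
      then obtain r where r: "r \<in> (S \<inter> (\<Inter>y\<in>T. {r. y \<otimes> r \<in> M' - used z t})) \<inter> (M' \<inter> (S - used z t)) \<inter> (S - N t)"
        using set_filter_ex_member[OF p(1)] by blast
      then have "r \<in> carrier G"
        using S by auto
      with r False have "P z t r"
        unfolding P_def T_def[symmetric] by auto
      then show ?thesis ..
    qed
  qed
  have "\<exists>z. \<forall>t. P z t (z t)"
  proof (rule dependent_wellorder_choice)
    \<comment> \<open>Admissibility at stage \<open>t\<close> depends only on earlier
      entries.\<close>
    fix r t and f g :: "nat \<Rightarrow> 'a"
    assume eq: "\<And>s. s < t \<Longrightarrow> f s = g s"
    have "prods G f i t = prods G g i t" for i
      using eq by (rule prods_cong)
    then show "P f t r = P g t r"
      by (simp add: P_def used_def)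
  qed (rule ex)
  then obtain z where z: "\<And>t. P z t (z t)"
    by blast
  have zS: "z t \<in> S" for t
    using z by (simp add: P_def)
  then have zc: "z t \<in> carrier G" for t
    using S by blast
  have z_new: "z t \<in> M' - used z t" for t
    using z[of t] zc by (simp add: P_def)
  have prods_sub: "prods G z i t \<subseteq> M'" for i t
    using prods_M' z by blast
  have z_used: "z s \<in> used z t" if "s < t" for s t
  proof -
    have "z s \<in> prods G z (fst (prod_decode s)) (Suc s)"
      using zc by simp
    then show ?thesis
      using prods_mono[of "Suc s" t G z] that unfolding used_def Suc_le_eq by blast
  qed
  show ?thesis
  proof (intro exI[of _ z] conjI allI impI)
    show "range z \<subseteq> M"
      using z_new M' by blast
    show "inj z"
      using z_new z_used by (metis DiffD2 linorder_injI)
    show "prods G z i t \<subseteq> M" for i t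
      using prods_sub M' by blast
    have disj: "prods G z i t \<inter> prods G z j t = {}" if "i \<noteq> j" for i j t
    proof (induction t)
      case (Suc t)
      have "(\<lambda>y. y \<otimes> z t) ` insert \<one> (prods G z (fst (prod_decode t)) t) \<inter> used z t = {}"
        using z[of t] by (auto simp: P_def)
      then have "(\<lambda>y. y \<otimes> z t) ` insert \<one> (prods G z (fst (prod_decode t)) t) \<inter> prods G z k t = {}" for k
        by (auto simp: used_def)
      then show ?case
        using Suc that unfolding prods.simps by (cases "fst (prod_decode t) = i"; cases "fst (prod_decode t) = j"; simp; blast)
    qed simp
    show "prods G z i s \<inter> prods G z j t = {}" if "i \<noteq> j" for i j s t
      using disj[OF that, of "max s t"] prods_mono[of s "max s t" G z i] prods_mono[of t "max s t" G z j]
      by auto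
    show "z t \<notin> N t" if "prods G z (fst (prod_decode t)) t \<noteq> {}" for t
      using z[of t] that by (simp add: P_def)
    show "U i \<inter> (\<Union>j t. prods G z j t) \<noteq> {}" if i: "U i \<inter> starters p M \<noteq> {}" for i
    proof -
      \<comment> \<open>The stage of the first term of the \<open>i\<close>-th sequence, where
        \<open>P\<close> takes care of \<open>U i\<close>.\<close>
      let ?t = "prod_encode (i, 0)"
      have "prods G z i ?t = {}"
        using zc by (subst prods_eq_foldr) auto
      then have "z ?t \<in> U i \<or> U i \<inter> M' \<subseteq> used z ?t"
        using z[of ?t] by (auto simp: P_def)
      then show ?thesis
        using i z_used[of ?t "Suc ?t"] unfolding M'_def used_def by blast
    qed
  qed
qed

section \<open>A closed set supporting an idempotent ultrafilter\<close>

lemma left_translation_homeomorphic_map: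
  fixes G (structure)
  assumes "left_topological_group G X" "g \<in> carrier G"
  shows "homeomorphic_map X X (\<lambda>x. g \<otimes>\<^bsub>G\<^esub> x)"
proof -
  interpret group G
    using assms(1) by (simp add: left_topological_group_def)
  have "homeomorphic_maps X X (\<lambda>x. g \<otimes> x) (\<lambda>x. inv g \<otimes> x)"
    using assms by (auto simp: homeomorphic_maps_def left_topological_group_def m_assoc[symmetric])
  then show ?thesis
    by (rule homeomorphic_maps_imp_map)
qed

lemma left_translation_vimage:
  fixes G (structure)
  assumes "left_topological_group G X" "g \<in> carrier G"
  shows "{x \<in> carrier G. g \<otimes>\<^bsub>G\<^esub> x \<in> A} = (\<lambda>x. inv\<^bsub>G\<^esub> g \<otimes>\<^bsub>G\<^esub> x) ` (A \<inter> carrier G)"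
proof -
  interpret group G
    using assms(1) by (simp add: left_topological_group_def)
  have "x \<in> (\<lambda>x. inv g \<otimes> x) ` (A \<inter> carrier G)" if "x \<in> carrier G" "g \<otimes> x \<in> A" for x
    using that assms(2) by (intro image_eqI[of _ _ "g \<otimes> x"]) (auto simp: m_assoc[symmetric])
  then show ?thesis
    using assms(2) by (auto simp: m_assoc[symmetric])
qed

text \<open>The preimage is an image under translation by the inverse, a homeomorphism.\<close>

lemma NC_left_translation_vimage:
  assumes "left_topological_group G X" "g \<in> carrier G" "A \<in> NC X"
  shows "{x \<in> carrier G. g \<otimes>\<^bsub>G\<^esub> x \<in> A} \<in> NC X"
proof -
  have "inv\<^bsub>G\<^esub> g \<in> carrier G"
    using assms(1,2) by (simp add: left_topological_group_def)
  moreover have "A \<inter> carrier G \<in> NC X"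
    by (rule NC_subset[OF assms(3)]) auto
  ultimately show ?thesis
    unfolding left_translation_vimage[OF assms(1,2)]
    by (intro NC_homeomorphic_image left_translation_homeomorphic_map[OF assms(1)])
qed

lemma closedin_left_translation_vimage:
  assumes "left_topological_group G X" "g \<in> carrier G" "closedin X A"
  shows "closedin X {x \<in> carrier G. g \<otimes>\<^bsub>G\<^esub> x \<in> A}"
  using assms closedin_continuous_map_preimage[of X X "\<lambda>x. g \<otimes>\<^bsub>G\<^esub> x" A]
  by (simp add: left_topological_group_def)

text \<open>
  A finite set that is large enough to contain every product which \<open>chains\<close> below allows to be
  extended by an element of \<open>B j\<close>.
\<close>

primrec initial_products :: "('a, 'b) monoid_scheme \<Rightarrow> (nat \<Rightarrow> 'a) \<Rightarrow> nat \<Rightarrow> 'a set" where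
  "initial_products G e 0 = {\<one>\<^bsub>G\<^esub>}"
| "initial_products G e (Suc j) =
     initial_products G e j \<union> (\<lambda>(y, i). y \<otimes>\<^bsub>G\<^esub> e i) ` (initial_products G e j \<times> {..j})"

lemma finite_initial_products: "finite (initial_products G e j)"
  by (induction j) auto

lemma initial_products_mono: "i \<le> j \<Longrightarrow> initial_products G e i \<subseteq> initial_products G e j"
  by (rule lift_Suc_mono_le) auto

lemma one_in_initial_products: "\<one>\<^bsub>G\<^esub> \<in> initial_products G e j"
  by (induction j) auto

lemma (in monoid) initial_products_subset:
  assumes "range e \<subseteq> carrier G"
  shows "initial_products G e j \<subseteq> carrier G"
proof -
  have "e i \<in> carrier G" for i
    using assms by blast
  then show ?thesis
    by (induction j) auto
qed

text \<open>
  An element \<open>(k, x)\<close> of \<open>chains G e B n\<close> consists of a product \<open>x\<close> of elements \<open>e i \<in> B j\<close> with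
  \<open>n \<le> j\<close>, and the least bound \<open>k\<close> on all the indices involved. Since only blocks beyond \<open>k\<close> may
  follow, each block \<open>B j\<close> has to cope with finitely many left factors only.
\<close>

inductive_set chains :: "('a, 'b) monoid_scheme \<Rightarrow> (nat \<Rightarrow> 'a) \<Rightarrow> (nat \<Rightarrow> 'a set) \<Rightarrow> nat \<Rightarrow> (nat \<times> 'a) set"
  for G e B n where
  start: "e i \<in> B j \<Longrightarrow> n \<le> j \<Longrightarrow> (max i j, e i) \<in> chains G e B n"
| step: "(k, x) \<in> chains G e B n \<Longrightarrow> e i \<in> B j \<Longrightarrow> k < j \<Longrightarrow>
    (max i j, x \<otimes>\<^bsub>G\<^esub> e i) \<in> chains G e B n"

lemma chains_antimono:
  assumes "m \<le> n"
  shows "chains G e B n \<subseteq> chains G e B m"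
proof clarify
  fix k x assume "(k, x) \<in> chains G e B n"
  then show "(k, x) \<in> chains G e B m"
    by induction (use assms in \<open>auto intro: chains.intros\<close>)
qed

text \<open>Induction on the second chain, reassociating one factor at a time. Its first block lies
  beyond \<open>k\<close>, as \<open>step\<close> demands after \<open>x\<close>.\<close>

lemma (in monoid) chains_mult:
  assumes e: "range e \<subseteq> S" and S: "subsemigroup G S"
    and x: "(k, x) \<in> chains G e B n" "x \<in> S"
    and y: "(l, y) \<in> chains G e B (Suc k)"
  shows "y \<in> S \<and> (l, x \<otimes> y) \<in> chains G e B n"
  using y
proof induction
  case (start i j)
  then show ?case
    using chains.step[OF x(1), of i j] e by auto
next
  case (step m y i j)
  have "y \<in> carrier G" "e i \<in> S" "e i \<in> carrier G" "x \<in> carrier G" "y \<otimes> e i \<in> S"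
    using step x e S by (auto simp: subsemigroup_def)
  then show ?case
    using chains.step[of m "x \<otimes> y" G e B n i j] step by (auto simp: m_assoc)
qed

text \<open>Being an initial product of stage \<open>Suc k\<close>, \<open>x\<close> is a permitted
  left factor for every block beyond \<open>k\<close>; hence the extended chain lies in a translate
  of that block.\<close>

lemma (in monoid) chains_subset:
  assumes e: "range e \<subseteq> S" and S: "subsemigroup G S" and x: "(k, x) \<in> chains G e B n"
  shows "x \<in> S \<and> x \<in> initial_products G e (Suc k) \<and>
    (\<exists>j. \<exists>y\<in>initial_products G e j. \<exists>b\<in>B j. x = y \<otimes> b)"
  using x
proof induction
  case (start i j)
  have "e i \<in> carrier G" "e i \<in> S"
    using e S by (auto simp: subsemigroup_def)
  then have "e i = \<one> \<otimes> e i"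
    by simp
  moreover have "(\<one>, i) \<in> initial_products G e (max i j) \<times> {..max i j}"
    by (simp add: one_in_initial_products)
  ultimately have "e i \<in> initial_products G e (Suc (max i j))"
    unfolding initial_products.simps by (intro UnI2 image_eqI[of _ _ "(\<one>, i)"]) auto
  then show ?case
    using start one_in_initial_products[of G e j] \<open>e i \<in> S\<close> \<open>e i = \<one> \<otimes> e i\<close> by blast
next
  case (step k x i j)
  have "x \<in> initial_products G e j"
    using step initial_products_mono[of "Suc k" j G e] by auto
  moreover from this have "(x, i) \<in> initial_products G e (max i j) \<times> {..max i j}"
    using initial_products_mono[of j "max i j" G e] by auto
  then have "x \<otimes> e i \<in> initial_products G e (Suc (max i j))"
    unfolding initial_products.simps by (intro UnI2 image_eqI[of _ _ "(x, i)"]) auto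
  moreover have "x \<otimes> e i \<in> S"
    using step e S by (auto simp: subsemigroup_def)
  ultimately show ?case
    using step by blast
qed

section \<open>Blocks whose translates escape to infinity\<close>

lemma ex_dense_sequence:
  assumes "second_countable X" "dense_in_open X S Q" "Q \<noteq> {}"
  obtains e :: "nat \<Rightarrow> 'a"
  where "range e \<subseteq> S \<inter> Q" "\<And>V. openin X V \<Longrightarrow> V \<subseteq> Q \<Longrightarrow> V \<noteq> {} \<Longrightarrow> range e \<inter> V \<noteq> {}"
proof -
  obtain U :: "nat \<Rightarrow> 'a set" where U: "\<And>n. openin X (U n)"
    "\<And>V x. openin X V \<Longrightarrow> x \<in> V \<Longrightarrow> \<exists>n. x \<in> U n \<and> U n \<subseteq> V"
    using second_countable_base_sequence[OF assms(1)] by metis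
  have Q: "openin X Q"
    using assms(2) by (simp add: dense_in_open_def)
  obtain x0 where x0: "x0 \<in> S \<inter> Q"
    using dense_in_openD[OF assms(2) Q _ assms(3)] by auto
  \<comment> \<open>\<open>x0\<close> is the default for basic sets that miss
    \<open>S \<inter> Q\<close>.\<close>
  define e where "e n = (if S \<inter> Q \<inter> U n = {} then x0 else SOME x. x \<in> S \<inter> Q \<inter> U n)" for n
  have e: "e n \<in> S \<inter> Q \<inter> U n" if "S \<inter> Q \<inter> U n \<noteq> {}" for n
  proof -
    have "(SOME x. x \<in> S \<inter> Q \<inter> U n) \<in> S \<inter> Q \<inter> U n"
      using that by (intro someI_ex[of "\<lambda>x. x \<in> S \<inter> Q \<inter> U n"]) blast
    then show ?thesis
      using that by (simp add: e_def)
  qed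
  have "e n \<in> S \<inter> Q" for n
    using e[of n] x0 by (cases "S \<inter> Q \<inter> U n = {}") (auto simp: e_def)
  then have "range e \<subseteq> S \<inter> Q"
    by blast
  moreover have "range e \<inter> V \<noteq> {}" if V: "openin X V" "V \<subseteq> Q" "V \<noteq> {}" for V
  proof -
    obtain x where x: "x \<in> V"
      using V(3) by blast
    then obtain n where n: "x \<in> U n" "U n \<subseteq> V"
      using U(2)[OF V(1)] by blast
    have "S \<inter> U n \<noteq> {}"
      using dense_in_openD[OF assms(2) U(1), of n] n V(2) by blast
    then have "S \<inter> Q \<inter> U n \<noteq> {}"
      using n(2) V(2) by blast
    then show ?thesis
      using e[of n] n(2) by blast
  qed
  ultimately show thesis
    by (rule that)
qed

text \<open>The finitely many translated preimages of \<open>D\<close> form a closed set in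
  \<open>NC X\<close>, which cannot cover \<open>Q\<close>. Local compactness provides a small block
  around a remaining point.\<close>

lemma ex_avoiding_open:
  assumes G: "left_topological_group G X" and X: "Hausdorff_space X" "locally_compact_space X"
    and Q: "openin X Q" "Q \<notin> NC X"
    and D: "closedin X D" "D \<in> NC X"
    and Y: "finite Y" "Y \<subseteq> carrier G"
  obtains B where "openin X B" "B \<noteq> {}" "B \<subseteq> Q" "compactin X (X closure_of B)"
    "\<And>y. y \<in> Y \<Longrightarrow> (\<lambda>x. y \<otimes>\<^bsub>G\<^esub> x) ` (X closure_of B) \<inter> D = {}"
proof -
  have top: "topspace X = carrier G"
    using G by (simp add: left_topological_group_def)
  define Z where "Z = (\<Union>y\<in>Y. {x \<in> carrier G. y \<otimes>\<^bsub>G\<^esub> x \<in> D})"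
  have "closedin X Z"
    unfolding Z_def using Y D(1) by (intro closedin_Union) (auto intro!: closedin_left_translation_vimage[OF G])
  then have W: "openin X (Q - Z)"
    using Q(1) by (rule openin_diff[rotated])
  have "Z \<in> NC X"
    unfolding Z_def using Y D(2) by (intro NC_Union_finite) (auto intro!: NC_left_translation_vimage[OF G])
  then obtain q where "q \<in> Q - Z"
    using Q(2) NC_subset[of Z X Q] by blast
  moreover have "neighbourhood_base_of (\<lambda>C. compactin X C \<and> closedin X C) X"
    using locally_compact_space_neighbourhood_base_closedin[of X] X by simp
  ultimately obtain B V where B: "openin X B" "compactin X V" "closedin X V" "q \<in> B" "B \<subseteq> V" "V \<subseteq> Q - Z"
    using W unfolding neighbourhood_base_of by meson
  have cl: "X closure_of B \<subseteq> V"
    using B(5,3) by (rule closure_of_minimal)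
  show thesis
  proof (rule that)
    show "openin X B" "B \<noteq> {}" "B \<subseteq> Q"
      using B by auto
    show "compactin X (X closure_of B)"
      using B(2) cl closedin_closure_of by (rule closed_compactin)
    fix y assume "y \<in> Y"
    have "x \<in> carrier G \<and> x \<notin> Z" if "x \<in> X closure_of B" for x
      using that cl B(6) closure_of_subset_topspace[of X B] by (auto simp: top)
    then show "(\<lambda>x. y \<otimes>\<^bsub>G\<^esub> x) ` (X closure_of B) \<inter> D = {}"
      using \<open>y \<in> Y\<close> unfolding Z_def by blast
  qed
qed

text \<open>\<open>U n\<close> meets at most \<open>F 0\<close>, ..., \<open>F n\<close>, so this
  union of closed sets is locally finite.\<close>

lemma closedin_Union_escaping:
  assumes U: "\<And>n. openin X (U n)" "(\<Union>n. U n) = topspace X"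
    and F: "\<And>j::nat. closedin X (F j)" "\<And>i n. n < i \<Longrightarrow> F i \<inter> U n = {}"
  shows "closedin X (\<Union>j. F j)"
proof -
  have sub: "(\<Union>j. F j) \<subseteq> topspace X"
    using closedin_subset[OF F(1)] by blast
  have "openin X (topspace X - (\<Union>j. F j))"
  proof (subst openin_subopen, intro ballI)
    fix x assume x: "x \<in> topspace X - (\<Union>j. F j)"
    then obtain n where n: "x \<in> U n"
      using U(2) by blast
    let ?W = "U n - (\<Union>j\<in>{..n}. F j)"
    have "closedin X (\<Union>j\<in>{..n}. F j)"
      using F(1) by (intro closedin_Union) auto
    then have "openin X ?W"
      using U(1) by (intro openin_diff)
    moreover have "x \<in> ?W"
      using n x by blast
    moreover have "y \<notin> F j" if "y \<in> ?W" for y j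
      using that F(2)[of n j] by (cases "j \<le> n") auto
    then have "?W \<subseteq> topspace X - (\<Union>j. F j)"
      using openin_subset[OF U(1), of n] by blast
    ultimately show "\<exists>T. openin X T \<and> x \<in> T \<and> T \<subseteq> topspace X - (\<Union>j. F j)"
      by blast
  qed
  then show ?thesis
    using sub by (simp add: closedin_def)
qed

text \<open>
  The blocks \<open>B j\<close> are pushed to infinity along the exhaustion \<open>U\<close> so fast that the translates of
  successive blocks are separated by the gaps \<open>U (Suc (m j)) - X closure_of U (m j)\<close>; these gaps
  keep the complement of \<open>F\<close> outside \<open>NC X\<close>.
\<close>

lemma ex_translates_avoiding:
  fixes G (structure)
  assumes G: "left_topological_group G X"
    and X: "Hausdorff_space X" "locally_compact_space X" "second_countable X"
    and C: "C \<in> NC X" and Q: "openin X Q" "Q \<notin> NC X" and e: "range e \<subseteq> carrier G"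
  obtains B F where "closedin X F" "F \<inter> C = {}" "topspace X - F \<notin> NC X"
    "\<And>j. openin X (B j)" "\<And>j. B j \<noteq> {}" "\<And>j. B j \<subseteq> Q"
    "\<And>j y x. y \<in> initial_products G e j \<Longrightarrow> x \<in> B j \<Longrightarrow> y \<otimes>\<^bsub>G\<^esub> x \<in> F"
    "\<And>K. compactin X K \<Longrightarrow> \<exists>i. \<forall>j\<ge>i. B j \<inter> K = {}"
proof -
  interpret group G
    using G by (simp add: left_topological_group_def)
  have top: "topspace X = carrier G"
    using G by (simp add: left_topological_group_def)
  have "\<not> compact_space X"
    using Q NC_subset[OF compactin_imp_NC openin_subset[OF Q(1)]] by (auto simp: compact_space_def)
  then obtain U :: "nat \<Rightarrow> 'a set" where U: "\<And>n. openin X (U n)" "\<And>n. compactin X (X closure_of U n)"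
    "\<And>n. X closure_of U n \<subset> U (Suc n)" "(\<Union>n. U n) = topspace X"
    using compact_exhaustion[OF X] by metis
  have U_cl: "U n \<subseteq> X closure_of U n" for n
    using closure_of_subset[OF openin_subset[OF U(1)]] .
  have U_Suc: "U n \<subseteq> U (Suc n)" for n
    using U_cl[of n] U(3)[of n] by blast
  have U_mono: "U i \<subseteq> U j" if "i \<le> j" for i j
    using lift_Suc_mono_le[of U i j] U_Suc that by simp
  have U_bound: "\<exists>n. K \<subseteq> U n" if K: "compactin X K" for K
    using compactin_subset_increasing_open_cover[of X K U] K U(1) U_Suc compactin_subset_topspace[OF K] U(4)
    by metis
  obtain C' where C': "C \<subseteq> C'" "closedin X C'" "C' \<in> NC X"
    using NC_subset_closedin[OF X(1) C] .
  \<comment> \<open>Collects the translates of the closure of \<open>B\<close> by all left factors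
    permitted for block number \<open>n\<close>.\<close>
  define T where "T n B = (\<Union>y\<in>initial_products G e n. (\<lambda>x. y \<otimes> x) ` (X closure_of B))" for n B
  have Y_carrier: "initial_products G e n \<subseteq> carrier G" for n
    by (rule initial_products_subset[OF e])
  have T_compact: "compactin X (T n B)" if "compactin X (X closure_of B)" for n B
    unfolding T_def
  proof (rule compactin_Union)
    show "finite ((\<lambda>y. (\<lambda>x. y \<otimes> x) ` (X closure_of B)) ` initial_products G e n)"
      by (simp add: finite_initial_products)
    fix A assume "A \<in> (\<lambda>y. (\<lambda>x. y \<otimes> x) ` (X closure_of B)) ` initial_products G e n"
    then obtain y where y: "y \<in> initial_products G e n" "A = (\<lambda>x. y \<otimes> x) ` (X closure_of B)"
      by blast
    then have "continuous_map X X (\<lambda>x. y \<otimes> x)"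
      using G Y_carrier[of n] by (auto simp: left_topological_group_def)
    then show "compactin X A"
      using image_compactin[OF that] y(2) by simp
  qed
  define good where "good n B m \<longleftrightarrow> openin X B \<and> B \<noteq> {} \<and> B \<subseteq> Q \<and> compactin X (X closure_of B) \<and>
      T n B \<inter> C' = {} \<and> T n B \<subseteq> U m" for n B m
  have step: "\<exists>B m. good n B m \<and> m0 < m \<and> T n B \<inter> X closure_of U (Suc m0) = {}" for n m0
  proof -
    \<comment> \<open>Using \<open>U (Suc m0)\<close> instead of \<open>U m0\<close> leaves a gap
      that no translate enters.\<close>
    let ?D = "C' \<union> X closure_of U (Suc m0)"
    have "closedin X ?D" "?D \<in> NC X"
      using C' U(2) by (auto intro: NC_Un compactin_imp_NC)
    then obtain B where B: "openin X B" "B \<noteq> {}" "B \<subseteq> Q" "compactin X (X closure_of B)"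
      "\<And>y. y \<in> initial_products G e n \<Longrightarrow> (\<lambda>x. y \<otimes> x) ` (X closure_of B) \<inter> ?D = {}"
      using ex_avoiding_open[OF G X(1,2) Q _ _ finite_initial_products Y_carrier] by metis
    obtain l where "T n B \<subseteq> U l"
      using U_bound[OF T_compact[OF B(4)]] by blast
    then have "T n B \<subseteq> U (max l (Suc m0))"
      using U_mono[of l "max l (Suc m0)"] by auto
    moreover have "T n B \<inter> C' = {}" "T n B \<inter> X closure_of U (Suc m0) = {}"
      unfolding T_def using B(5) by blast+
    ultimately have "good n B (max l (Suc m0))"
      using B(1-4) by (simp add: good_def)
    then show ?thesis
      using \<open>T n B \<inter> X closure_of U (Suc m0) = {}\<close>
      by (intro exI[of _ B] exI[of _ "max l (Suc m0)"]) simp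
  qed
  have "\<exists>f. \<forall>n. good n (fst (f n)) (snd (f n)) \<and> (snd (f n) < snd (f (Suc n)) \<and>
      T (Suc n) (fst (f (Suc n))) \<inter> X closure_of U (Suc (snd (f n))) = {})"
  proof (rule dependent_nat_choice)
    show "\<exists>p. good 0 (fst p) (snd p)"
      using step[of 0 0] by (metis fst_conv snd_conv)
    show "\<exists>q. good (Suc n) (fst q) (snd q) \<and>
        (snd p < snd q \<and> T (Suc n) (fst q) \<inter> X closure_of U (Suc (snd p)) = {})" for p n
      using step[of "Suc n" "snd p"] by (metis fst_conv snd_conv)
  qed
  then obtain f where f: "\<And>n. good n (fst (f n)) (snd (f n)) \<and> (snd (f n) < snd (f (Suc n)) \<and>
      T (Suc n) (fst (f (Suc n))) \<inter> X closure_of U (Suc (snd (f n))) = {})"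
    by blast
  define B where "B n = fst (f n)" for n
  define m where "m n = snd (f n)" for n
  have B: "openin X (B n)" "B n \<noteq> {}" "B n \<subseteq> Q" "compactin X (X closure_of B n)" for n
    using f[of n] by (simp_all add: B_def good_def)
  have TB: "T n (B n) \<inter> C' = {}" "T n (B n) \<subseteq> U (m n)" "m n < m (Suc n)"
    "T (Suc n) (B (Suc n)) \<inter> X closure_of U (Suc (m n)) = {}" for n
    using f[of n] by (simp_all add: B_def m_def good_def)
  have m: "strict_mono m"
    using TB(3) by (simp add: strict_mono_Suc_iff)
  have far: "T i (B i) \<inter> X closure_of U (Suc (m n)) = {}" if "n < i" for n i
  proof -
    obtain l where l: "i = Suc l" "n \<le> l"
      using \<open>n < i\<close> by (cases i) auto
    have "X closure_of U (Suc (m n)) \<subseteq> X closure_of U (Suc (m l))"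
      using l(2) m by (intro closure_of_mono U_mono) (simp add: strict_mono_less_eq)
    then show ?thesis
      using TB(4)[of l] l(1) by blast
  qed
  have U_m: "U n \<subseteq> U (m n)" for n
    using U_mono strict_mono_imp_increasing[OF m] by simp
  have far': "T i (B i) \<inter> U n = {}" if "n < i" for i n
    using far[OF that] U_m[of n] U_Suc[of "m n"] U_cl[of "Suc (m n)"] by blast
  have B_T: "y \<otimes> x \<in> T j (B j)" if "y \<in> initial_products G e j" "x \<in> B j" for j x y
    using that closure_of_subset[OF openin_subset[OF B(1)], of j] unfolding T_def by blast
  define F where "F = (\<Union>j. T j (B j))"
  show thesis
  proof (rule that)
    show "closedin X F"
      unfolding F_def
      by (rule closedin_Union_escaping[OF U(1,4)])
        (use T_compact[OF B(4)] X(1) far' in \<open>auto intro: compactin_imp_closedin\<close>)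
    show "F \<inter> C = {}"
      using TB(1) C'(1) unfolding F_def by blast
    show "topspace X - F \<notin> NC X"
    proof
      assume "topspace X - F \<in> NC X"
      moreover have "openin X (topspace X - F)"
        using \<open>closedin X F\<close> by blast
      ultimately have "compactin X (X closure_of (topspace X - F))"
        using NC_openin_iff[OF X(1)] by blast
      then obtain n where n: "X closure_of (topspace X - F) \<subseteq> U n"
        using U_bound by blast
      \<comment> \<open>A point of the \<open>n\<close>-th gap: translates up to block
        \<open>n\<close> lie inside \<open>U (m n)\<close>, later ones miss
        \<open>U (Suc (m n))\<close>. So \<open>x\<close> is outside \<open>F\<close>, but also
        outside \<open>U n\<close>.\<close>
      obtain x where x: "x \<in> U (Suc (m n))" "x \<notin> X closure_of U (m n)"
        using U(3)[of "m n"] by blast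
      have "x \<notin> T i (B i)" for i
      proof (cases "i \<le> n")
        case True
        then have "U (m i) \<subseteq> U (m n)"
          using m by (intro U_mono) (simp add: strict_mono_less_eq)
        then show ?thesis
          using TB(2)[of i] x(2) U_cl[of "m n"] by blast
      next
        case False
        then show ?thesis
          using far[of n i] x(1) U_cl[of "Suc (m n)"] by auto
      qed
      then have "x \<in> topspace X - F"
        using x(1) U(4) by (auto simp: F_def)
      then have "x \<in> U n"
        using n closure_of_subset[of "topspace X - F" X] by blast
      then show False
        using x(2) U_m[of n] U_cl[of "m n"] by blast
    qed
    show "openin X (B j)" "B j \<noteq> {}" "B j \<subseteq> Q" for j
      using B by auto
    show "y \<otimes> x \<in> F" if "y \<in> initial_products G e j" "x \<in> B j" for j x y
      using B_T[OF that] by (auto simp: F_def)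
    show "\<exists>i. \<forall>j\<ge>i. B j \<inter> K = {}" if K: "compactin X K" for K
    proof -
      obtain n where n: "K \<subseteq> U n"
        using U_bound[OF K] by blast
      have "B j \<inter> K = {}" if "n < j" for j
      proof -
        \<comment> \<open>The unit is a permitted left factor, so the blocks escape along with their
          translates.\<close>
        have "x \<in> T j (B j)" if "x \<in> B j" for x
          using B_T[OF one_in_initial_products that] that openin_subset[OF B(1), of j] by (auto simp: top)
        then show ?thesis
          using far'[OF \<open>n < j\<close>] n by blast
      qed
      then show ?thesis
        by (intro exI[of _ "Suc n"]) auto
    qed
  qed
qed

text \<open>\<open>H n\<close> consists of the products that start in block \<open>n\<close> or
  later. It is dense in each of these blocks, which leave every compact set, so it is not in
  \<open>NC X\<close>.\<close>

lemma ex_positive_tails: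
  fixes G (structure)
  assumes G: "left_topological_group G X"
    and X: "Hausdorff_space X" "locally_compact_space X" "second_countable X"
    and C: "C \<in> NC X" and S: "subsemigroup G S" "dense_in_noncompact_open X S"
  obtains F H where "closedin X F" "F \<inter> C = {}" "topspace X - F \<notin> NC X"
    "\<And>n::nat. H n \<subseteq> S \<inter> F" "\<And>n. H n \<notin> NC X" "\<And>m n. m \<le> n \<Longrightarrow> H n \<subseteq> H m"
    "\<And>n x. x \<in> H n \<Longrightarrow> \<exists>m. \<forall>y\<in>H m. x \<otimes>\<^bsub>G\<^esub> y \<in> H n"
proof -
  interpret group G
    using G by (simp add: left_topological_group_def)
  have S_carrier: "S \<subseteq> carrier G"
    using S(1) by (simp add: subsemigroup_def)
  obtain Q where Q: "dense_in_open X S Q" "\<not> compactin X (X closure_of Q)"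
    using S(2) by (auto simp: dense_in_noncompact_open_def)
  have Q_open: "openin X Q"
    using Q(1) by (simp add: dense_in_open_def)
  have Q_NC: "Q \<notin> NC X"
    using Q(2) NC_openin_iff[OF X(1) Q_open] by simp
  have "Q \<noteq> {}"
    using Q(2) by auto
  then obtain e :: "nat \<Rightarrow> 'a" where e: "range e \<subseteq> S \<inter> Q"
    "\<And>V. openin X V \<Longrightarrow> V \<subseteq> Q \<Longrightarrow> V \<noteq> {} \<Longrightarrow> range e \<inter> V \<noteq> {}"
    using ex_dense_sequence[OF X(3) Q(1)] by metis
  have eS: "range e \<subseteq> S"
    using e(1) by blast
  then have "range e \<subseteq> carrier G"
    using S_carrier by blast
  then obtain B F where F: "closedin X F" "F \<inter> C = {}" "topspace X - F \<notin> NC X"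
    and B: "\<And>j. openin X (B j)" "\<And>j. B j \<noteq> {}" "\<And>j. B j \<subseteq> Q"
    and BF: "\<And>j y x. y \<in> initial_products G e j \<Longrightarrow> x \<in> B j \<Longrightarrow> y \<otimes> x \<in> F"
    and far: "\<And>K. compactin X K \<Longrightarrow> \<exists>i. \<forall>j\<ge>i. B j \<inter> K = {}"
    using ex_translates_avoiding[OF G X C Q_open Q_NC] by metis
  define H where "H n = snd ` chains G e B n" for n
  show thesis
  proof (rule that[OF F])
    show "H n \<subseteq> S \<inter> F" for n
      using chains_subset[OF eS S(1)] BF unfolding H_def by fastforce
    show "H n \<subseteq> H m" if "m \<le> n" for m n
      unfolding H_def by (intro image_mono chains_antimono that)
    show "\<exists>m. \<forall>y\<in>H m. x \<otimes> y \<in> H n" if "x \<in> H n" for n x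
    proof -
      obtain k where k: "(k, x) \<in> chains G e B n"
        using \<open>x \<in> H n\<close> by (auto simp: H_def)
      then have "x \<in> S"
        using chains_subset[OF eS S(1)] by blast
      have "x \<otimes> y \<in> H n" if "y \<in> H (Suc k)" for y
      proof -
        obtain l where "(l, y) \<in> chains G e B (Suc k)"
          using \<open>y \<in> H (Suc k)\<close> by (auto simp: H_def)
        then have "(l, x \<otimes> y) \<in> chains G e B n"
          using chains_mult[OF eS S(1) k \<open>x \<in> S\<close>] by blast
        then show ?thesis
          by (force simp: H_def)
      qed
      then show ?thesis
        by blast
    qed
    show "H n \<notin> NC X" for n
    proof
      assume "H n \<in> NC X"
      then obtain K N where K: "compactin X K" and N: "nowhere_dense_in X N" and sub: "H n \<subseteq> K \<union> N"
        by (auto simp: NC_def)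
      obtain i where i: "\<And>j. i \<le> j \<Longrightarrow> B j \<inter> K = {}"
        using far[OF K] by blast
      define j where "j = max i n"
      \<comment> \<open>This block misses \<open>K\<close>, so the points \<open>e l\<close> in it,
        which are dense there, all lie in \<open>N\<close>.\<close>
      have "B j \<subseteq> X closure_of N"
      proof
        fix x assume x: "x \<in> B j"
        show "x \<in> X closure_of N"
          unfolding in_closure_of
        proof (intro conjI allI impI)
          show "x \<in> topspace X"
            using x openin_subset[OF B(1)] by blast
          fix V assume V: "x \<in> V \<and> openin X V"
          have "range e \<inter> (V \<inter> B j) \<noteq> {}"
            using V x B(1,3)[of j] by (intro e(2)) auto
          then obtain l where l: "e l \<in> V" "e l \<in> B j"
            by blast
          have "(max l j, e l) \<in> chains G e B n"
            using l(2) by (rule chains.start) (simp add: j_def)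
          then have "e l \<in> H n"
            by (force simp: H_def)
          then have "e l \<in> N"
            using sub i[of j] l(2) by (auto simp: j_def)
          then show "\<exists>y. y \<in> N \<and> y \<in> V"
            using l(1) by blast
        qed
      qed
      then have "B j \<subseteq> X interior_of (X closure_of N)"
        using B(1) by (rule interior_of_maximal)
      then show False
        using N B(2)[of j] by (auto simp: nowhere_dense_in_def)
    qed
  qed
qed

text \<open>The tail condition and the translation invariance of \<open>NC X\<close> make a filter
  of tails shift closed, so that an idempotent ultrafilter lies above it.\<close>

lemma ex_idempotent_tail_ultrafilter:
  fixes G (structure)
  assumes G: "left_topological_group G X" and S: "subsemigroup G S"
    and H: "\<And>n::nat. H n \<subseteq> S" "\<And>n. H n \<notin> NC X" "\<And>m n. m \<le> n \<Longrightarrow> H n \<subseteq> H m"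
    "\<And>n x. x \<in> H n \<Longrightarrow> \<exists>m. \<forall>y\<in>H m. x \<otimes>\<^bsub>G\<^esub> y \<in> H n"
  obtains p where "set_filter S p" "shift_closed (\<lambda>x y. x \<otimes>\<^bsub>G\<^esub> y) p"
    "\<And>A. A \<in> p \<or> - A \<in> p" "H 0 \<in> p" "\<And>A. A \<in> NC X \<Longrightarrow> S - A \<in> p"
proof -
  interpret group G
    using G by (simp add: left_topological_group_def)
  have S_carrier: "S \<subseteq> carrier G" and S_mult: "\<And>x y. x \<in> S \<Longrightarrow> y \<in> S \<Longrightarrow> x \<otimes> y \<in> S"
    using S by (auto simp: subsemigroup_def)
  \<comment> \<open>The filter generated by the tails and the complements of sets in
    \<open>NC X\<close>.\<close>
  define \<phi> where "\<phi> = {A. \<exists>n. H n - A \<in> NC X}"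
  have empty_NC: "{} \<in> NC X"
    by (simp add: finite_imp_NC)
  have H_\<phi>: "H n \<in> \<phi>" for n
    unfolding \<phi>_def using empty_NC by (intro CollectI exI[of _ n]) simp
  have \<phi>_mono: "B \<in> \<phi>" if AB: "A \<in> \<phi>" "A \<subseteq> B" for A B
  proof -
    obtain n where "H n - A \<in> NC X"
      using AB by (auto simp: \<phi>_def)
    then have "H n - B \<in> NC X"
      by (rule NC_subset) (use AB in blast)
    then show ?thesis
      by (auto simp: \<phi>_def)
  qed
  have "A \<inter> B \<in> \<phi>" if AB: "A \<in> \<phi>" "B \<in> \<phi>" for A B
  proof -
    obtain m n where mn: "H m - A \<in> NC X" "H n - B \<in> NC X"
      using AB by (auto simp: \<phi>_def)
    have "H (max m n) - A \<inter> B \<subseteq> (H m - A) \<union> (H n - B)"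
      using H(3)[of m "max m n"] H(3)[of n "max m n"] by auto
    then have "H (max m n) - A \<inter> B \<in> NC X"
      by (rule NC_subset[OF NC_Un[OF mn]])
    then show ?thesis
      by (auto simp: \<phi>_def)
  qed
  moreover have "S \<in> \<phi>"
    using \<phi>_mono[OF H_\<phi> H(1)] .
  moreover have "{} \<notin> \<phi>"
    using H(2) by (simp add: \<phi>_def)
  ultimately have filt: "set_filter S \<phi>"
    using \<phi>_mono unfolding set_filter_def by blast
  have shift: "shift_closed (\<lambda>x y. x \<otimes> y) \<phi>"
    unfolding shift_closed_def
  proof
    fix A assume "A \<in> \<phi>"
    then obtain n where n: "H n - A \<in> NC X"
      by (auto simp: \<phi>_def)
    have "{y. x \<otimes> y \<in> A} \<in> \<phi>" if x: "x \<in> H n" for x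
    proof -
      obtain m where m: "\<And>y. y \<in> H m \<Longrightarrow> x \<otimes> y \<in> H n"
        using H(4)[OF x] by blast
      have "x \<in> carrier G"
        using x H(1) S_carrier by blast
      then have "{y \<in> carrier G. x \<otimes> y \<in> H n - A} \<in> NC X"
        using NC_left_translation_vimage[OF G _ n] by blast
      then have "H m - {y. x \<otimes> y \<in> A} \<in> NC X"
        by (rule NC_subset) (use m H(1) S_carrier in blast)
      then show ?thesis
        by (auto simp: \<phi>_def)
    qed
    then show "{x. {y. x \<otimes> y \<in> A} \<in> \<phi>} \<in> \<phi>"
      by (intro \<phi>_mono[OF H_\<phi>[of n]]) blast
  qed
  have assoc: "(x \<otimes> y) \<otimes> z = x \<otimes> (y \<otimes> z)" if "x \<in> S" "y \<in> S" "z \<in> S" for x y z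
    using that S_carrier by (intro m_assoc) auto
  have "\<exists>p. set_filter S p \<and> shift_closed (\<lambda>x y. x \<otimes> y) p \<and> \<phi> \<subseteq> p \<and> (\<forall>A. A \<in> p \<or> - A \<in> p)"
    by (rule ex_idempotent_ultrafilter[OF S_mult assoc filt shift])
  then obtain p where p: "set_filter S p" "shift_closed (\<lambda>x y. x \<otimes> y) p" "\<phi> \<subseteq> p"
    "\<forall>A. A \<in> p \<or> - A \<in> p"
    by blast
  show thesis
  proof (rule that[OF p(1,2) p(4)[rule_format]])
    show "H 0 \<in> p"
      using H_\<phi> p(3) by blast
    fix A assume "A \<in> NC X"
    then have "H 0 - (S - A) \<in> NC X"
      by (rule NC_subset) (use H(1) in blast)
    then show "S - A \<in> p"
      using p(3) by (auto simp: \<phi>_def)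
  qed
qed

text \<open>Otherwise the complements of the finitely many classes all lie in \<open>p\<close>, but
  together they leave nothing of \<open>D\<close>.\<close>

lemma ultrafilter_ex_color:
  assumes p: "set_filter S p" "\<And>A. A \<in> p \<or> - A \<in> p" and D: "D \<in> p" "finite_coloring D c"
  obtains k where "{x \<in> D. c x = k} \<in> p"
proof (rule ccontr)
  assume "\<not> thesis"
  then have "{x \<in> D. c x = k} \<notin> p" for k
    using that by blast
  then have "- {x \<in> D. c x = k} \<in> p" for k
    using p(2) by blast
  then have "S \<inter> (\<Inter>k\<in>c ` D. - {x \<in> D. c x = k}) \<in> p"
    using D(2) by (intro set_filter_finite_INT[OF p(1)]) (auto simp: finite_coloring_def)
  then have "D \<inter> (S \<inter> (\<Inter>k\<in>c ` D. - {x \<in> D. c x = k})) \<in> p"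
    by (rule set_filter_Int[OF p(1) D(1)])
  moreover have "D \<inter> (S \<inter> (\<Inter>k\<in>c ` D. - {x \<in> D. c x = k})) = {}"
    by auto
  ultimately show False
    using set_filter_empty[OF p(1)] by simp
qed

section \<open>Assembly of the family of sequences\<close>

theorem theorem1p9:
  fixes G :: "('a, 'b) monoid_scheme" and X :: "'a topology" and C S :: "'a set"
  assumes "left_topological_group G X"
    and "Polish_topology X"
    and "locally_compact_space X"
    and "C \<in> NC X"
    and "subsemigroup G S"
    and "dense_in_noncompact_open X S"
  shows "\<exists>P. openin X P \<and> C \<subseteq> P \<and> P \<in> ideal_positive (carrier G) (NC X) \<and>
    (\<forall>c :: 'a \<Rightarrow> nat. finite_coloring (S - P) c \<longrightarrow>
      (\<exists>\<A> :: (nat \<Rightarrow> 'a) set.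
        (\<forall>A\<in>\<A>. inj A \<and> range A \<subseteq> S - P) \<and>
        (\<forall>A\<in>\<A>. closed_discrete_in X (range A)) \<and>
        monochromatic (S - P) c (\<Union>A\<in>\<A>. FS G A) \<and>
        (\<forall>A\<in>\<A>. \<forall>B\<in>\<A>. A \<noteq> B \<longrightarrow> FS G A \<inter> FS G B = {}) \<and>
        dense_in_noncompact_open X (\<Union>A\<in>\<A>. FS G A) \<and>
        (nicely_exhaustive G X S (NC X) \<longrightarrow> (\<forall>A\<in>\<A>. closed_discrete_in X (FS G A)))))"
proof -
  note G = assms(1) and C = assms(4) and S = assms(5,6)
  interpret group G
    using G by (simp add: left_topological_group_def)
  have top: "topspace X = carrier G"
    using G by (simp add: left_topological_group_def)
  have S_carrier: "S \<subseteq> carrier G" and S_mult: "\<And>x y. x \<in> S \<Longrightarrow> y \<in> S \<Longrightarrow> x \<otimes>\<^bsub>G\<^esub> y \<in> S"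
    using S by (auto simp: subsemigroup_def)
  have metrizable: "metrizable_space X" and separable: "separable_space X"
    using assms(2) by (auto simp: Polish_topology_def completely_metrizable_imp_metrizable_space)
  have Hausdorff: "Hausdorff_space X"
    using metrizable by (rule metrizable_imp_Hausdorff_space)
  have t1: "t1_space X"
    using Hausdorff by (rule Hausdorff_imp_t1_space)
  have sc: "second_countable X"
    using metrizable separable by (rule separable_metrizable_imp_second_countable)
  note X = Hausdorff assms(3) sc
  have noncompact: "\<not> compact_space X"
    using S(2) closedin_compact_space[of X] by (auto simp: dense_in_noncompact_open_def)
  obtain F H where F: "closedin X F" "F \<inter> C = {}" "topspace X - F \<notin> NC X"
    and H: "\<And>n::nat. H n \<subseteq> S \<inter> F" "\<And>n. H n \<notin> NC X" "\<And>m n. m \<le> n \<Longrightarrow> H n \<subseteq> H m"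
    "\<And>n x. x \<in> H n \<Longrightarrow> \<exists>m. \<forall>y\<in>H m. x \<otimes>\<^bsub>G\<^esub> y \<in> H n"
    using ex_positive_tails[OF G X C S] by metis
  have HS: "H n \<subseteq> S" for n
    using H(1) by blast
  obtain p where p: "set_filter S p" "shift_closed (\<lambda>x y. x \<otimes>\<^bsub>G\<^esub> y) p"
    and ultra: "\<And>A. A \<in> p \<or> - A \<in> p" and H_p: "H 0 \<in> p" and NC_p: "\<And>A. A \<in> NC X \<Longrightarrow> S - A \<in> p"
    using ex_idempotent_tail_ultrafilter[OF G S(1) HS H(2-4)] by metis
  define P where "P = topspace X - F"
  have "H 0 \<subseteq> S - P"
    using H(1)[of 0] by (auto simp: P_def)
  then have SP: "S - P \<in> p"
    using set_filter_mono[OF p(1) H_p] by blast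
  obtain W where W: "\<And>n. openin X (W n)" "\<And>n. compactin X (X closure_of W n)"
    "\<And>n. X closure_of W n \<subset> W (Suc n)" "(\<Union>n. W n) = topspace X"
    using compact_exhaustion[OF X noncompact] by metis
  have W_cl: "W n \<subseteq> X closure_of W n" for n
    using closure_of_subset[OF openin_subset[OF W(1)]] .
  have W_NC: "W n \<in> NC X" for n
    using NC_openin_iff[OF Hausdorff W(1)] W(2) by blast
  have W_Suc: "W n \<subseteq> W (Suc n)" for n
    using W_cl[of n] W(3)[of n] by blast
  have W_mono: "W i \<subseteq> W j" if "i \<le> j" for i j
    using lift_Suc_mono_le[of W i j] W_Suc that by simp
  \<comment> \<open>Without a nice exhaustion \<open>E\<close> is constantly empty, so one
    construction serves both cases.\<close>
  obtain E :: "nat \<Rightarrow> 'a set" where E: "\<And>i. E i \<in> NC X"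
    "nicely_exhaustive G X S (NC X) \<Longrightarrow> (\<forall>i. openin X (E i)) \<and> (\<Union>i. E i) = carrier G \<and>
      (\<forall>i. E i \<subseteq> E (Suc i)) \<and> (\<forall>i. left_ideal_of G S (S - E i))"
  proof (cases "nicely_exhaustive G X S (NC X)")
    case True
    then obtain A :: "nat \<Rightarrow> 'a set" where "\<forall>i. A i \<in> NC X \<and> openin X (A i)" "(\<Union>i. A i) = carrier G"
      "\<forall>i. A i \<subseteq> A (Suc i)" "\<forall>i. S - A i \<noteq> {} \<and> left_ideal_of G S (S - A i)"
      unfolding nicely_exhaustive_def by blast
    then show thesis
      using that[of A] by blast
  next
    case False
    then show thesis
      using that[of "\<lambda>_. {}"] finite_imp_NC[of "{}" X] by simp
  qed
  obtain U :: "nat \<Rightarrow> 'a set" where U: "\<And>n. openin X (U n)"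
    "\<And>V x. openin X V \<Longrightarrow> x \<in> V \<Longrightarrow> \<exists>n. x \<in> U n \<and> U n \<subseteq> V"
    using second_countable_base_sequence[OF sc] by metis
  have "\<exists>\<A>. (\<forall>A\<in>\<A>. inj A \<and> range A \<subseteq> S - P) \<and>
        (\<forall>A\<in>\<A>. closed_discrete_in X (range A)) \<and>
        monochromatic (S - P) c (\<Union>A\<in>\<A>. FS G A) \<and>
        (\<forall>A\<in>\<A>. \<forall>B\<in>\<A>. A \<noteq> B \<longrightarrow> FS G A \<inter> FS G B = {}) \<and>
        dense_in_noncompact_open X (\<Union>A\<in>\<A>. FS G A) \<and>
        (nicely_exhaustive G X S (NC X) \<longrightarrow> (\<forall>A\<in>\<A>. closed_discrete_in X (FS G A)))"
    if c: "finite_coloring (S - P) c" for c :: "'a \<Rightarrow> nat"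
  proof -
    obtain k where k: "{x \<in> S - P. c x = k} \<in> p"
      using ultrafilter_ex_color[OF p(1) ultra SP c] .
    define M where "M = {x \<in> S - P. c x = k}"
    have M: "M \<in> p" "M \<subseteq> S"
      using k by (auto simp: M_def)
    \<comment> \<open>Avoiding \<open>W t\<close> drives the terms to infinity; under nice
      exhaustion, avoiding \<open>E t\<close> controls all products.\<close>
    have N: "S - (W t \<union> E t) \<in> p" for t
      using NC_p NC_Un[OF W_NC E(1)] by blast
    have fin: "\<forall>D. finite D \<longrightarrow> S - D \<in> p"
    proof (intro allI impI)
      fix D :: "'a set"
      assume "finite D"
      then have "S - (D \<inter> topspace X) \<in> p"
        by (intro NC_p finite_imp_NC) auto
      moreover have "S - (D \<inter> topspace X) = S - D"
        using S_carrier top by blast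
      ultimately show "S - D \<in> p"
        by simp
    qed
    obtain z where z: "range z \<subseteq> M" "inj z"
      and prods_all: "\<forall>i t. prods G z i t \<subseteq> M"
        "\<forall>i j s t. i \<noteq> j \<longrightarrow> prods G z i s \<inter> prods G z j t = {}"
        "\<forall>t. prods G z (fst (prod_decode t)) t \<noteq> {} \<longrightarrow> z t \<notin> W t \<union> E t"
        "\<forall>i. U i \<inter> starters p M \<noteq> {} \<longrightarrow> U i \<inter> (\<Union>j t. prods G z j t) \<noteq> {}"
      using ex_disjoint_FS_sequences[where U = U and N = "\<lambda>t. W t \<union> E t", OF p S_carrier M N fin]
      by (elim exE conjE) (rule that; assumption)
    note prods_M = prods_all(1)[rule_format] and prods_disjoint = prods_all(2)[rule_format]
      and z_avoid = prods_all(3)[rule_format] and z_dense = prods_all(4)[rule_format]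
    have z_carrier: "range z \<subseteq> carrier G"
      using z(1) M(2) S_carrier by blast
    define a where "a i = (\<lambda>k. z (prod_encode (i, k)))" for i
    have FS_a: "FS G (a i) = (\<Union>t. prods G z i t)" for i
      unfolding a_def by (rule FS_eq_Union_prods[OF z_carrier])
    have FS_M: "FS G (a i) \<subseteq> M" for i
      using prods_M by (auto simp: FS_a)
    have prods_nonempty: "prods G z i t \<noteq> {}" if "prod_encode (i, 0) < t" for i t
    proof -
      have "prods G z i (Suc (prod_encode (i, 0))) \<noteq> {}"
        by simp
      moreover have "prods G z i (Suc (prod_encode (i, 0))) \<subseteq> prods G z i t"
        using that by (intro prods_mono) (rule Suc_leI)
      ultimately show ?thesis
        by blast
    qed
    have a_closed: "closed_discrete_in X (range (a i))" for i
    proof (rule closed_discrete_in_locally_finite[OF t1 _ _ W(1)])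
      show "range (a i) \<subseteq> topspace X"
        using z_carrier by (auto simp: a_def top)
      show "topspace X \<subseteq> (\<Union>n. W n)"
        using W(4) by simp
      fix n
      \<comment> \<open>The first term is exempt from avoidance; terms chosen from stage
        \<open>n\<close> on miss \<open>W n\<close> because \<open>W\<close> increases.\<close>
      have "range (a i) \<inter> W n \<subseteq> insert (a i 0) (z ` {..<n})"
      proof
        fix x assume x: "x \<in> range (a i) \<inter> W n"
        then obtain l where l: "x = z (prod_encode (i, l))"
          by (auto simp: a_def)
        show "x \<in> insert (a i 0) (z ` {..<n})"
        proof (cases "l = 0 \<or> prod_encode (i, l) < n")
          case True
          then show ?thesis
            using l by (auto simp: a_def)
        next
          case False
          then have "x \<notin> W (prod_encode (i, l))"
            using z_avoid[of "prod_encode (i, l)"] prods_nonempty[of i "prod_encode (i, l)"] l by simp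
          then show ?thesis
            using x W_mono[of n "prod_encode (i, l)"] False by auto
        qed
      qed
      then show "finite (range (a i) \<inter> W n)"
        by (rule finite_subset) simp
    qed
    have FS_closed: "closed_discrete_in X (FS G (a i))" if nice: "nicely_exhaustive G X S (NC X)" for i
    proof (rule closed_discrete_in_locally_finite[OF t1])
      show "FS G (a i) \<subseteq> topspace X"
        using FS_M[of i] M(2) S_carrier by (auto simp: top)
      show "topspace X \<subseteq> (\<Union>n. E n)" "openin X (E n)" for n
        using E(2)[OF nice] by (auto simp: top)
      fix n
      \<comment> \<open>From stage \<open>n0\<close> on, the first term is already chosen and all
        new terms of the sequence avoid \<open>E n\<close>.\<close>
      define n0 where "n0 = max n (Suc (prod_encode (i, 0)))"
      have "prods G z i t \<inter> E n \<subseteq> prods G z i n0" for t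
      proof (induction t)
        case (Suc t)
        show ?case
        proof (cases "t < n0")
          case True
          then show ?thesis
            using prods_mono[of "Suc t" n0 G z i] by auto
        next
          case False
          \<comment> \<open>\<open>S - E n\<close> is a left ideal, so a left factor
            \<open>y\<close> cannot bring the new term back into \<open>E n\<close>.\<close>
          have "y \<otimes>\<^bsub>G\<^esub> z t \<notin> E n" if "fst (prod_decode t) = i" "y \<in> insert \<one>\<^bsub>G\<^esub> (prods G z i t)" for y
          proof -
            have zS: "z t \<in> S"
              using z(1) M(2) by blast
            have "z t \<notin> E t"
              using z_avoid[of t] prods_nonempty[of i t] False that by (auto simp: n0_def)
            moreover have "E n \<subseteq> E t"
              using lift_Suc_mono_le[of E n t] E(2)[OF nice] False by (auto simp: n0_def)
            ultimately have "z t \<in> S - E n"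
              using zS by blast
            moreover have "z t \<in> carrier G"
              using zS S_carrier by blast
            moreover have "y = \<one>\<^bsub>G\<^esub> \<or> y \<in> S"
              using that prods_M[of i t] M(2) by blast
            ultimately show ?thesis
              using E(2)[OF nice] by (auto simp: left_ideal_of_def)
          qed
          then show ?thesis
            using Suc by auto
        qed
      qed simp
      then have "FS G (a i) \<inter> E n \<subseteq> (\<Union>j. prods G z j n0)"
        unfolding FS_a by blast
      then show "finite (FS G (a i) \<inter> E n)"
        using finite_Union_prods by (rule finite_subset)
    qed
    have dense: "dense_in_noncompact_open X (\<Union>A\<in>range a. FS G A)"
    proof -
      define M' where "M' = starters p M"
      \<comment> \<open>\<open>M'\<close> is in \<open>p\<close>, hence not in \<open>NC X\<close>,
        which makes the closure of \<open>Q\<close> non-compact.\<close>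
      define Q where "Q = X interior_of (X closure_of M')"
      have M': "M' \<in> p" "M' \<subseteq> M"
        using starters_mem[OF p M(1)] by (auto simp: M'_def starters_def)
      have "M' \<notin> NC X"
      proof
        assume "M' \<in> NC X"
        then have "M' \<inter> (S - M') \<in> p"
          using M'(1) NC_p by (intro set_filter_Int[OF p(1)])
        then show False
          using set_filter_empty[OF p(1)] by simp
      qed
      moreover have "M' \<subseteq> topspace X"
        using M' M(2) S_carrier by (auto simp: top)
      ultimately have "\<not> compactin X (X closure_of Q)"
        unfolding Q_def by (intro not_NC_imp_interior_closure_noncompact)
      moreover have "dense_in_open X (\<Union>A\<in>range a. FS G A) Q"
      proof (rule dense_in_openI)
        show "openin X Q"
          by (simp add: Q_def)
        fix V assume V: "openin X V" "V \<subseteq> Q" "V \<noteq> {}"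
        then obtain x where "x \<in> V" "x \<in> X closure_of M'"
          using interior_of_subset[of X "X closure_of M'"] by (auto simp: Q_def)
        then obtain y where y: "y \<in> M'" "y \<in> V"
          using V(1) by (auto simp: in_closure_of)
        \<comment> \<open>This basic set meets \<open>M'\<close>, so the construction placed a
          product in it.\<close>
        then obtain n where "y \<in> U n" "U n \<subseteq> V"
          using U(2)[OF V(1)] by blast
        then show "(\<Union>A\<in>range a. FS G A) \<inter> V \<noteq> {}"
          using z_dense[of n] y(1) by (auto simp: M'_def FS_a)
      qed
      ultimately show ?thesis
        by (auto simp: dense_in_noncompact_open_def)
    qed
    show ?thesis
    proof (intro exI[of _ "range a"] conjI)
      have "inj (a i)" for i
      proof (rule injI)
        fix k l assume "a i k = a i l"
        then have "prod_encode (i, k) = prod_encode (i, l)"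
          unfolding a_def by (rule injD[OF z(2)])
        then show "k = l"
          by simp
      qed
      moreover have "range (a i) \<subseteq> S - P" for i
        using z(1) by (auto simp: a_def M_def)
      ultimately show "\<forall>A\<in>range a. inj A \<and> range A \<subseteq> S - P"
        by blast
      show "\<forall>A\<in>range a. closed_discrete_in X (range A)"
        using a_closed by blast
      show "monochromatic (S - P) c (\<Union>A\<in>range a. FS G A)"
      proof -
        have "(\<Union>A\<in>range a. FS G A) \<subseteq> M"
          using FS_M by blast
        then show ?thesis
          unfolding monochromatic_def M_def by blast
      qed
      show "\<forall>A\<in>range a. \<forall>B\<in>range a. A \<noteq> B \<longrightarrow> FS G A \<inter> FS G B = {}"
      proof (intro ballI impI)
        fix A B assume "A \<in> range a" "B \<in> range a" "A \<noteq> B"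
        then obtain i j where ij: "A = a i" "B = a j" "i \<noteq> j"
          by blast
        have "x \<notin> prods G z j t" if "x \<in> prods G z i s" for x s t
          using prods_disjoint[OF ij(3), of s t] that by blast
        then show "FS G A \<inter> FS G B = {}"
          unfolding ij(1,2) FS_a by blast
      qed
      show "dense_in_noncompact_open X (\<Union>A\<in>range a. FS G A)"
        by (rule dense)
      show "nicely_exhaustive G X S (NC X) \<longrightarrow> (\<forall>A\<in>range a. closed_discrete_in X (FS G A))"
        using FS_closed by blast
    qed
  qed
  moreover have "openin X P"
    using F(1) by (simp add: P_def openin_diff)
  moreover have "C \<subseteq> P"
  proof -
    obtain K N where "compactin X K" "nowhere_dense_in X N" "C \<subseteq> K \<union> N"
      using C by (auto simp: NC_def)
    then have "C \<subseteq> topspace X"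
      using compactin_subset_topspace[of X K] by (auto simp: nowhere_dense_in_def)
    then show ?thesis
      using F(2) by (auto simp: P_def)
  qed
  moreover have "P \<in> ideal_positive (carrier G) (NC X)"
    using F(3) by (auto simp: ideal_positive_def P_def top)
  ultimately show ?thesis
    by (intro exI[of _ P] conjI allI impI)
qed

end
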